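(* Let $m, n \in \mathbb{N}$ with $m \geq 3$, $n \geq 2$, and let $K$ be a field containing a primitive $m$-th root of unity $q$. Let $\xi$ be a generator of the cyclic group $U_n(K)$, let $\nu(n)=|U_n(K)|$, and let $t, t' \in \{0, 1,\dots, \nu(n)-1\}$. Then the Hopf algebras $T_{nm^{2}}^{\xi^{t}}(q)$ and $T_{nm^{2}}^{\xi^{t'}}(q)$ are isomorphic if and only if there exist $l \in \{0, 1,\dots, m-1\}$ and $s \in \{0, 1,\dots, n-1\}$ such that $\gcd(s, n) = 1$ and $\xi^{st' - t} = q^{l}$.
   Context: All algebras, Hopf algebras and tensor products are over $K$. $U_n(K)=\{\omega\in K \mid \omega^n=1\}$ is the cyclic group of $n$-th roots of unity in $K$ (its order $\nu(n)$ divides $n$). A primitive $m$-th root of unity is a generator of $U_m(K)$ when $|U_m(K)|=m$. For $\omega\in U_n(K)$, $T_{nm^{2}}^{\omega}(q)$ (abbreviated $T_{nm^2}^{\omega}$) denotes the $nm^2$-dimensional Hopf algebra generated as an algebra by $g$, $h$, $x$ subject to $g^{n}=h^{m}=1$, $x^{m}=0$, $xh=qhx$, $hg=gh$, $gx=\omega xg$, with $\Delta(g)=g\otimes g$, $\Delta(h)=h\otimes h$, $\Delta(x)=x\otimes h+1\otimes x$, $\varepsilon(h)=\varepsilon(g)=1$, $\varepsilon(x)=0$, $S(h)=h^{m-1}$, $S(x)=-xh^{m-1}$, $S(g)=g^{n-1}$. *)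

theory Defs
  imports
    "HOL-Algebra.Module"
    "HOL-Algebra.QuotRing"
    "HOL-Algebra.Generated_Groups"
    "HOL-Library.Poly_Mapping"
begin

text \<open>
  The ground field \<open>K\<close> is a type \<open>'k\<close> of class \<^class>\<open>field\<close>. A \<open>K\<close>-algebra is
  carried by the record type \<^typ>\<open>('k, 'a) module\<close>, that is, a ring together with a scalar
  multiplication. Finite formal \<open>K\<close>-linear combinations of elements of a type are of type
  \<^typ>\<open>'b \<Rightarrow>\<^sub>0 'k\<close>.
\<close>

section \<open>Roots of unity\<close>

definition roots_of_unity :: "nat \<Rightarrow> 'k::field monoid" where
  "roots_of_unity n = \<lparr>carrier = {\<omega>. \<omega> ^ n = 1}, monoid.mult = (*), one = 1\<rparr>"

definition generates_group :: "('a, 'm) monoid_scheme \<Rightarrow> 'a \<Rightarrow> bool" where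
  "generates_group G a \<longleftrightarrow> a \<in> carrier G \<and> generate G {a} = carrier G"

definition primitive_root_of_unity :: "nat \<Rightarrow> 'k::field \<Rightarrow> bool" where
  "primitive_root_of_unity m q \<longleftrightarrow>
     order (roots_of_unity m :: 'k monoid) = m \<and> generates_group (roots_of_unity m) q"

section \<open>Tensor products of algebras\<close>

definition scale :: "'k::field \<Rightarrow> ('b \<Rightarrow>\<^sub>0 'k) \<Rightarrow> ('b \<Rightarrow>\<^sub>0 'k)" where
  "scale c = Poly_Mapping.map ((*) c)"

abbreviation formal_tensor :: "'a \<Rightarrow> 'b \<Rightarrow> ('a \<times> 'b) \<Rightarrow>\<^sub>0 'k::field" where
  "formal_tensor a b \<equiv> Poly_Mapping.single (a, b) 1"

text \<open>
  \<open>A \<otimes> B\<close> is the space of formal combinations of pairs from \<open>carrier A \<times> carrier B\<close> modulo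
  the subspace generated by the bilinearity relations.
\<close>

inductive_set tensor_null ::
  "('k::field, 'a, 'm) module_scheme \<Rightarrow> ('k, 'b, 'n) module_scheme \<Rightarrow> (('a \<times> 'b) \<Rightarrow>\<^sub>0 'k) set"
  for A :: "('k::field, 'a, 'm) module_scheme" and B :: "('k, 'b, 'n) module_scheme" where
  zero: "0 \<in> tensor_null A B"
| add: "u \<in> tensor_null A B \<Longrightarrow> v \<in> tensor_null A B \<Longrightarrow> u + v \<in> tensor_null A B"
| scale: "u \<in> tensor_null A B \<Longrightarrow> scale c u \<in> tensor_null A B"
| add_left: "a \<in> carrier A \<Longrightarrow> a' \<in> carrier A \<Longrightarrow> b \<in> carrier B \<Longrightarrow>
    formal_tensor (a \<oplus>\<^bsub>A\<^esub> a') b - formal_tensor a b - formal_tensor a' b \<in> tensor_null A B"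
| add_right: "a \<in> carrier A \<Longrightarrow> b \<in> carrier B \<Longrightarrow> b' \<in> carrier B \<Longrightarrow>
    formal_tensor a (b \<oplus>\<^bsub>B\<^esub> b') - formal_tensor a b - formal_tensor a b' \<in> tensor_null A B"
| smult_left: "a \<in> carrier A \<Longrightarrow> b \<in> carrier B \<Longrightarrow>
    formal_tensor (c \<odot>\<^bsub>A\<^esub> a) b - scale c (formal_tensor a b) \<in> tensor_null A B"
| smult_right: "a \<in> carrier A \<Longrightarrow> b \<in> carrier B \<Longrightarrow>
    formal_tensor a (c \<odot>\<^bsub>B\<^esub> b) - scale c (formal_tensor a b) \<in> tensor_null A B"

definition tensor_class ::
  "('k::field, 'a, 'm) module_scheme \<Rightarrow> ('k, 'b, 'n) module_scheme \<Rightarrow>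
   (('a \<times> 'b) \<Rightarrow>\<^sub>0 'k) \<Rightarrow> (('a \<times> 'b) \<Rightarrow>\<^sub>0 'k) set" where
  "tensor_class A B u = (\<lambda>z. u + z) ` tensor_null A B"

definition pure_tensor ::
  "('k::field, 'a, 'm) module_scheme \<Rightarrow> ('k, 'b, 'n) module_scheme \<Rightarrow>
   'a \<Rightarrow> 'b \<Rightarrow> (('a \<times> 'b) \<Rightarrow>\<^sub>0 'k) set" where
  "pure_tensor A B a b = tensor_class A B (formal_tensor a b)"

text \<open>The bilinear extension of \<open>(a \<otimes> b) (c \<otimes> d) = a c \<otimes> b d\<close>.\<close>

definition formal_mult ::
  "('k::field, 'a, 'm) module_scheme \<Rightarrow> ('k, 'b, 'n) module_scheme \<Rightarrow>
   (('a \<times> 'b) \<Rightarrow>\<^sub>0 'k) \<Rightarrow> (('a \<times> 'b) \<Rightarrow>\<^sub>0 'k) \<Rightarrow> (('a \<times> 'b) \<Rightarrow>\<^sub>0 'k)" where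
  "formal_mult A B u v =
     (\<Sum>(a, b)\<in>Poly_Mapping.keys u. \<Sum>(c, d)\<in>Poly_Mapping.keys v.
        scale (Poly_Mapping.lookup u (a, b) * Poly_Mapping.lookup v (c, d))
          (formal_tensor (a \<otimes>\<^bsub>A\<^esub> c) (b \<otimes>\<^bsub>B\<^esub> d)))"

text \<open>
  As for \<^const>\<open>rcoset_mult\<close>, an operation on classes is written as the union of the classes of
  the results over all representatives; the operations respect classes, so this union is a
  single class.
\<close>

definition tensor_algebra ::
  "('k::field, 'a, 'm) module_scheme \<Rightarrow> ('k, 'b, 'n) module_scheme \<Rightarrow>
   ('k, (('a \<times> 'b) \<Rightarrow>\<^sub>0 'k) set) module" where
  "tensor_algebra A B =
     \<lparr>carrier = tensor_class A B ` {u. Poly_Mapping.keys u \<subseteq> carrier A \<times> carrier B},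
      monoid.mult = (\<lambda>U V. \<Union>u\<in>U. \<Union>v\<in>V. tensor_class A B (formal_mult A B u v)),
      one = pure_tensor A B \<one>\<^bsub>A\<^esub> \<one>\<^bsub>B\<^esub>,
      zero = tensor_class A B 0,
      add = (\<lambda>U V. \<Union>u\<in>U. \<Union>v\<in>V. tensor_class A B (u + v)),
      smult = (\<lambda>c U. \<Union>u\<in>U. tensor_class A B (scale c u))\<rparr>"

text \<open>\<open>f \<otimes> g : A \<otimes> B \<rightarrow> C \<otimes> D\<close>, for linear \<open>f : A \<rightarrow> C\<close> and \<open>g : B \<rightarrow> D\<close>.\<close>

definition tensor_map ::
  "('k::field, 'c, 'm) module_scheme \<Rightarrow> ('k, 'd, 'n) module_scheme \<Rightarrow>
   ('a \<Rightarrow> 'c) \<Rightarrow> ('b \<Rightarrow> 'd) \<Rightarrow> (('a \<times> 'b) \<Rightarrow>\<^sub>0 'k) set \<Rightarrow> (('c \<times> 'd) \<Rightarrow>\<^sub>0 'k) set" where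
  "tensor_map C D f g U =
     (\<Union>u\<in>U. tensor_class C D
        (\<Sum>(a, b)\<in>Poly_Mapping.keys u.
           scale (Poly_Mapping.lookup u (a, b)) (formal_tensor (f a) (g b))))"

section \<open>Hopf algebras and their isomorphisms\<close>

text \<open>
  The record carries the structure maps only, as the records of HOL-Algebra do; the values of
  the comultiplication are elements of \<^term>\<open>tensor_algebra A A\<close>. An isomorphism is a bijection
  that preserves all of the structure (preservation of the antipode is automatic for
  bialgebra maps between Hopf algebras).
\<close>

record (overloaded) ('k::zero, 'a) hopf_algebra = "('k, 'a) module" +
  comult :: "'a \<Rightarrow> (('a \<times> 'a) \<Rightarrow>\<^sub>0 'k) set"
  counit :: "'a \<Rightarrow> 'k"
  antipode :: "'a \<Rightarrow> 'a"

definition algebra_iso ::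
  "('k, 'a, 'm) module_scheme \<Rightarrow> ('k, 'b, 'n) module_scheme \<Rightarrow> ('a \<Rightarrow> 'b) set" where
  "algebra_iso A B =
     {f \<in> ring_iso A B. \<forall>c. \<forall>a\<in>carrier A. f (c \<odot>\<^bsub>A\<^esub> a) = c \<odot>\<^bsub>B\<^esub> f a}"

definition hopf_iso ::
  "('k::field, 'a, 'm) hopf_algebra_scheme \<Rightarrow> ('k, 'b, 'n) hopf_algebra_scheme \<Rightarrow>
   ('a \<Rightarrow> 'b) set" where
  "hopf_iso A B =
     {f \<in> algebra_iso A B. \<forall>a\<in>carrier A.
        comult B (f a) = tensor_map B B f f (comult A a) \<and>
        counit B (f a) = counit A a \<and>
        antipode B (f a) = f (antipode A a)}"

definition hopf_isomorphic ::
  "('k::field, 'a, 'm) hopf_algebra_scheme \<Rightarrow> ('k, 'b, 'n) hopf_algebra_scheme \<Rightarrow> bool" where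
  "hopf_isomorphic A B \<longleftrightarrow> hopf_iso A B \<noteq> {}"

section \<open>The free algebra on three generators\<close>

datatype gen = Gen_g | Gen_h | Gen_x

text \<open>
  Words form the free monoid under concatenation. The class \<^class>\<open>monoid_add\<close> does not assume
  commutativity, and with it the product of \<^typ>\<open>gen list \<Rightarrow>\<^sub>0 'k\<close> is the convolution
  product of the free algebra.
\<close>

instantiation list :: (type) monoid_add
begin

definition zero_list :: "'a list" where "zero_list = []"

definition plus_list :: "'a list \<Rightarrow> 'a list \<Rightarrow> 'a list" where "plus_list = (@)"

instance by standard (simp_all add: zero_list_def plus_list_def)

end

type_synonym 'k free = "gen list \<Rightarrow>\<^sub>0 'k"

definition free_algebra :: "('k::field, 'k free) module" where
  "free_algebra =
     \<lparr>carrier = UNIV, monoid.mult = (*), one = 1, zero = 0, add = (+), smult = scale\<rparr>"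

definition free_gen :: "gen \<Rightarrow> 'k::field free" where
  "free_gen y = Poly_Mapping.single [y] 1"

text \<open>The algebra map from the free algebra to \<open>B\<close> that sends each generator \<open>y\<close> to \<open>\<phi> y\<close>.\<close>

definition free_lift ::
  "('k::field, 'b, 'm) module_scheme \<Rightarrow> (gen \<Rightarrow> 'b) \<Rightarrow> 'k free \<Rightarrow> 'b" where
  "free_lift B \<phi> p =
     (\<Oplus>\<^bsub>B\<^esub>w\<in>Poly_Mapping.keys p.
        Poly_Mapping.lookup p w \<odot>\<^bsub>B\<^esub> foldr (\<lambda>y b. \<phi> y \<otimes>\<^bsub>B\<^esub> b) w \<one>\<^bsub>B\<^esub>)"

definition quotient_algebra ::
  "('k, 'a, 'm) module_scheme \<Rightarrow> 'a set \<Rightarrow> ('k, 'a set) module" where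
  "quotient_algebra A I =
     ring.extend (A Quot I) (module.fields (\<lambda>c X. \<Union>a\<in>X. I +>\<^bsub>A\<^esub> (c \<odot>\<^bsub>A\<^esub> a)))"

definition scalar_algebra :: "('k::field, 'k) module" where
  "scalar_algebra =
     \<lparr>carrier = UNIV, monoid.mult = (*), one = 1, zero = 0, add = (+), smult = (*)\<rparr>"

definition opposite_algebra :: "('k, 'a, 'm) module_scheme \<Rightarrow> ('k, 'a, 'm) module_scheme" where
  "opposite_algebra A = A\<lparr>monoid.mult := \<lambda>a b. b \<otimes>\<^bsub>A\<^esub> a\<rparr>"

section \<open>The Hopf algebras \<open>T\<close>\<close>

definition T_relations :: "nat \<Rightarrow> nat \<Rightarrow> 'k::field \<Rightarrow> 'k \<Rightarrow> 'k free set" where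
  "T_relations n m q \<omega> =
     (let g = free_gen Gen_g; h = free_gen Gen_h; x = free_gen Gen_x in
      {g ^ n - 1, h ^ m - 1, x ^ m,
       x * h - scale q (h * x), h * g - g * h, g * x - scale \<omega> (x * g)})"

definition T_ideal :: "nat \<Rightarrow> nat \<Rightarrow> 'k::field \<Rightarrow> 'k \<Rightarrow> 'k free set" where
  "T_ideal n m q \<omega> = genideal free_algebra (T_relations n m q \<omega>)"

definition T_algebra :: "nat \<Rightarrow> nat \<Rightarrow> 'k::field \<Rightarrow> 'k \<Rightarrow> ('k, 'k free set) module" where
  "T_algebra n m q \<omega> = quotient_algebra free_algebra (T_ideal n m q \<omega>)"

definition T_gen :: "nat \<Rightarrow> nat \<Rightarrow> 'k::field \<Rightarrow> 'k \<Rightarrow> gen \<Rightarrow> 'k free set" where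
  "T_gen n m q \<omega> y = T_ideal n m q \<omega> +>\<^bsub>free_algebra\<^esub> free_gen y"

text \<open>
  The values of comultiplication, counit and antipode on the generators. The first two extend to
  algebra maps \<open>T \<rightarrow> T \<otimes> T\<close> and \<open>T \<rightarrow> K\<close>; the antipode extends to an anti-algebra map, that is,
  an algebra map from \<open>T\<close> to its opposite.
\<close>

definition T_comult_gen ::
  "nat \<Rightarrow> nat \<Rightarrow> 'k::field \<Rightarrow> 'k \<Rightarrow> gen \<Rightarrow> (('k free set \<times> 'k free set) \<Rightarrow>\<^sub>0 'k) set" where
  "T_comult_gen n m q \<omega> y =
     (let T = T_algebra n m q \<omega>;
          g = T_gen n m q \<omega> Gen_g; h = T_gen n m q \<omega> Gen_h; x = T_gen n m q \<omega> Gen_x in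
      case y of
        Gen_g \<Rightarrow> pure_tensor T T g g
      | Gen_h \<Rightarrow> pure_tensor T T h h
      | Gen_x \<Rightarrow> pure_tensor T T x h \<oplus>\<^bsub>tensor_algebra T T\<^esub> pure_tensor T T \<one>\<^bsub>T\<^esub> x)"

definition T_counit_gen :: "gen \<Rightarrow> 'k::field" where
  "T_counit_gen y = (case y of Gen_g \<Rightarrow> 1 | Gen_h \<Rightarrow> 1 | Gen_x \<Rightarrow> 0)"

definition T_antipode_gen :: "nat \<Rightarrow> nat \<Rightarrow> 'k::field \<Rightarrow> 'k \<Rightarrow> gen \<Rightarrow> 'k free set" where
  "T_antipode_gen n m q \<omega> y =
     (let T = T_algebra n m q \<omega>;
          g = T_gen n m q \<omega> Gen_g; h = T_gen n m q \<omega> Gen_h; x = T_gen n m q \<omega> Gen_x in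
      case y of
        Gen_g \<Rightarrow> g [^]\<^bsub>T\<^esub> (n - 1)
      | Gen_h \<Rightarrow> h [^]\<^bsub>T\<^esub> (m - 1)
      | Gen_x \<Rightarrow> \<ominus>\<^bsub>T\<^esub> (x \<otimes>\<^bsub>T\<^esub> h [^]\<^bsub>T\<^esub> (m - 1)))"

text \<open>
  An element of \<open>T\<close> is a coset of the ideal. If \<open>q\<close> is a primitive \<open>m\<close>-th root of unity and
  \<open>\<omega>\<close> is an \<open>n\<close>-th root of unity, then the lifts to the free algebra are constant on cosets,
  so \<^const>\<open>the_elem\<close> below returns their common value.
\<close>

definition T_hopf :: "nat \<Rightarrow> nat \<Rightarrow> 'k::field \<Rightarrow> 'k \<Rightarrow> ('k, 'k free set) hopf_algebra" where
  "T_hopf n m q \<omega> =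
     (let T = T_algebra n m q \<omega> in
      module.extend T
        (hopf_algebra.fields
          (\<lambda>Y. the_elem (free_lift (tensor_algebra T T) (T_comult_gen n m q \<omega>) ` Y))
          (\<lambda>Y. the_elem (free_lift scalar_algebra T_counit_gen ` Y))
          (\<lambda>Y. the_elem (free_lift (opposite_algebra T) (T_antipode_gen n m q \<omega>) ` Y))))"

end

theory Submission
  imports Defs "HOL-Algebra.Multiplicative_Group" "HOL-Number_Theory.Cong"
begin

text \<open>
  Write \<open>T(\<omega>)\<close> for the Hopf algebra with parameter \<open>\<omega>\<close>, and let \<open>\<omega> = \<xi>\<^sup>t\<close>, \<open>\<omega>' = \<xi>\<^bsup>t'\<^esup>\<close>. The
  arithmetic condition says that \<open>\<omega>'\<^sup>s = q\<^sup>l \<omega>\<close> for some \<open>l\<close> and some \<open>s\<close> prime to \<open>n\<close>.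

  If it holds, then \<open>g \<mapsto> g\<^sup>s h\<^sup>l\<close>, \<open>h \<mapsto> h\<close>, \<open>x \<mapsto> x\<close> defines a map \<open>T(\<omega>) \<rightarrow> T(\<omega>')\<close>: moving \<open>x\<close> past
  \<open>g\<^sup>s h\<^sup>l\<close> in \<open>T(\<omega>')\<close> costs the factor \<open>\<omega>'\<^sup>s q\<^sup>-\<^sup>l = \<omega>\<close>, and \<open>(g\<^sup>s h\<^sup>l)\<^sup>n = 1\<close> because \<open>q\<^sup>l\<close> is an
  \<open>n\<close>-th root of unity. The image of \<open>g\<close> is group-like, so the map respects the Hopf structure, and
  a map of the same shape, built from an inverse of \<open>s\<close> modulo \<open>n\<close>, is inverse to it
  (\<open>twist_map_inverse\<close>, \<open>hopf_isomorphic_if\<close>). All of these maps, and the structure maps of \<open>T(\<omega>)\<close>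
  themselves, come from the universal property of generators and relations
  (\<open>T_universal_property\<close>), and all identities between them are checked on generators
  (\<open>T_hom_eqI\<close>). The comultiplication exists because \<open>(x \<otimes> h + 1 \<otimes> x)\<^sup>m = 0\<close>: the two summands commute up
  to \<open>q\<close>, and the inner \<open>q\<close>-binomial coefficients of \<open>m\<close> vanish at a primitive \<open>m\<close>-th root of
  unity (\<open>nilpotent_sum\<close>).

  For the converse, consider characters \<open>\<alpha>\<close>, \<open>\<beta>\<close> of \<open>T(\<omega>)\<close> and a non-split extension between them,
  that is, an algebra map to the upper triangular 2 by 2 matrices with diagonal \<open>(\<alpha>, \<beta>)\<close> that
  is not conjugate to a diagonal one. If \<open>\<alpha> \<noteq> \<beta>\<close>, then the commuting elements \<open>g\<close> and \<open>h\<close> can be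
  diagonalised together, so \<open>x\<close> has a nonzero entry off the diagonal, and \<open>g x = \<omega> x g\<close> gives
  \<open>\<alpha>(g) = \<omega> \<beta>(g)\<close> (\<open>non_split_T\<close>). In \<open>T(\<omega>')\<close> there is a chain of such extensions that links the
  characters \<open>g \<mapsto> \<omega>'\<^sup>-\<^sup>k\<close>, \<open>h \<mapsto> q\<^sup>k\<close>, \<open>x \<mapsto> 0\<close> for \<open>k = 0, 1, 2, \<dots>\<close>, and it returns to its start whenever
  \<open>m\<close> divides \<open>k\<close> and \<open>\<omega>'\<^sup>k = 1\<close>. An isomorphism carries it to a chain in \<open>T(\<omega>)\<close>, where every step
  divides the value at \<open>g\<close> by \<open>\<omega>\<close>; hence \<open>\<omega>\<^sup>k = 1\<close> (\<open>root_of_unity_invariant\<close>). By symmetry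
  \<open>\<omega>\<^sup>m\<close> and \<open>\<omega>'\<^sup>m\<close> are powers of \<open>\<xi>\<close> of the same order, so one is the \<open>s\<close>-th power of the other with
  \<open>s\<close> prime to \<open>n\<close> (\<open>same_annihilator_imp_unit_multiple\<close>). Then \<open>\<omega>'\<^sup>s / \<omega>\<close> is an \<open>m\<close>-th root of unity,
  which is a power of \<open>q\<close>.
\<close>

section \<open>Formal linear combinations\<close>

lemma lookup_scale [simp]: "Poly_Mapping.lookup (scale c u) p = c * Poly_Mapping.lookup u p"
  unfolding scale_def by (simp add: Poly_Mapping.map.rep_eq when_def)

lemma scale_simps [simp]:
  "scale c (0 :: 'b \<Rightarrow>\<^sub>0 'k::field) = 0" "scale 0 u = 0" "scale 1 u = u"
  "scale c (scale d u) = scale (c * d) u"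
  "scale c (Poly_Mapping.single p d) = Poly_Mapping.single p (c * d)"
  by (auto intro!: poly_mapping_eqI simp: lookup_single when_def)

lemma scale_add: "scale c (u + v) = scale c u + scale c v"
  by (rule poly_mapping_eqI) (simp add: lookup_add algebra_simps)

lemma scale_diff: "scale c (u - v) = scale c u - scale c v"
  by (rule poly_mapping_eqI) (simp add: lookup_minus algebra_simps)

lemma scale_add_scalar: "scale (c + d) u = scale c u + scale d u"
  by (rule poly_mapping_eqI) (simp add: lookup_add algebra_simps)

lemma scale_minus_one: "scale (- 1) u = - u"
  by (rule poly_mapping_eqI) simp

lemma scale_sum: "scale c (sum f S) = (\<Sum>p\<in>S. scale c (f p))"
  by (induction S rule: infinite_finite_induct) (simp_all add: scale_add)

lemma keys_scale_subset: "Poly_Mapping.keys (scale c u) \<subseteq> Poly_Mapping.keys u"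
  by (auto simp: in_keys_iff)

lemma keys_plus:
  "Poly_Mapping.keys u \<subseteq> S \<Longrightarrow> Poly_Mapping.keys v \<subseteq> S \<Longrightarrow> Poly_Mapping.keys (u + v) \<subseteq> S"
  using keys_add[of u v] by blast

lemma keys_minus:
  "Poly_Mapping.keys u \<subseteq> S \<Longrightarrow> Poly_Mapping.keys v \<subseteq> S \<Longrightarrow> Poly_Mapping.keys (u - v) \<subseteq> S"
  using keys_diff[of u v] by blast

lemma keys_scale:
  "Poly_Mapping.keys u \<subseteq> S \<Longrightarrow> Poly_Mapping.keys (scale c u) \<subseteq> S"
  using keys_scale_subset[of c u] by blast

lemma sum_monomials: "(\<Sum>p\<in>Poly_Mapping.keys u. Poly_Mapping.single p (Poly_Mapping.lookup u p)) = u"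
proof (rule poly_mapping_eqI)
  fix p
  show "Poly_Mapping.lookup (\<Sum>p\<in>Poly_Mapping.keys u.
      Poly_Mapping.single p (Poly_Mapping.lookup u p)) p = Poly_Mapping.lookup u p"
    by (simp add: lookup_sum lookup_single when_def in_keys_iff)
qed

text \<open>
  Identities between multilinear expressions reduce by this rule to monomials. The support is
  confined to a set \<open>S\<close> because the algebra axioms hold only inside carriers.
\<close>

lemma linear_combination_induct [consumes 1, case_names zero single add]:
  fixes u :: "'b \<Rightarrow>\<^sub>0 'k::comm_monoid_add"
  assumes keys: "Poly_Mapping.keys u \<subseteq> S"
    and zero: "P 0"
    and single: "\<And>p c. p \<in> S \<Longrightarrow> P (Poly_Mapping.single p c)"
    and add: "\<And>u v. Poly_Mapping.keys u \<subseteq> S \<Longrightarrow> Poly_Mapping.keys v \<subseteq> S \<Longrightarrow>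
      P u \<Longrightarrow> P v \<Longrightarrow> P (u + v)"
  shows "P u"
proof -
  have "P (\<Sum>p\<in>T. Poly_Mapping.single p (Poly_Mapping.lookup u p)) \<and>
    Poly_Mapping.keys (\<Sum>p\<in>T. Poly_Mapping.single p (Poly_Mapping.lookup u p)) \<subseteq> S"
    if "finite T" "T \<subseteq> S" for T
    using that
  proof (induction T)
    case (insert p T)
    have *: "Poly_Mapping.keys (Poly_Mapping.single p (Poly_Mapping.lookup u p)) \<subseteq> S"
      using insert by simp
    then show ?case
      using insert keys_add[of "Poly_Mapping.single p (Poly_Mapping.lookup u p)"]
      by (simp add: add single) blast
  qed (simp add: zero)
  from this[OF _ keys] show ?thesis by (simp add: sum_monomials)
qed

definition extend_linear :: "('p \<Rightarrow> ('r \<Rightarrow>\<^sub>0 'k::field)) \<Rightarrow> ('p \<Rightarrow>\<^sub>0 'k) \<Rightarrow> ('r \<Rightarrow>\<^sub>0 'k)" where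
  "extend_linear f u = (\<Sum>p\<in>Poly_Mapping.keys u. scale (Poly_Mapping.lookup u p) (f p))"

lemma extend_linear_superset:
  assumes "finite S" "Poly_Mapping.keys u \<subseteq> S"
  shows "extend_linear f u = (\<Sum>p\<in>S. scale (Poly_Mapping.lookup u p) (f p))"
  unfolding extend_linear_def using assms
  by (intro sum.mono_neutral_left) (auto simp: in_keys_iff)

lemma extend_linear_add: "extend_linear f (u + v) = extend_linear f u + extend_linear f v"
proof -
  let ?S = "Poly_Mapping.keys u \<union> Poly_Mapping.keys v"
  have *: "finite ?S" by simp
  show ?thesis
    using extend_linear_superset[OF *, of u f] extend_linear_superset[OF *, of v f]
      extend_linear_superset[OF *, of "u + v" f] keys_add[of u v]
    by (simp add: lookup_add scale_add_scalar sum.distrib)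
qed

lemma extend_linear_zero [simp]: "extend_linear f 0 = 0"
  by (simp add: extend_linear_def)

lemma extend_linear_single [simp]:
  "extend_linear f (Poly_Mapping.single p c) = scale c (f p)"
  by (simp add: extend_linear_def)

lemma extend_linear_scale: "extend_linear f (scale c u) = scale c (extend_linear f u)"
proof -
  have "extend_linear f (scale c u) =
      (\<Sum>p\<in>Poly_Mapping.keys u. scale (Poly_Mapping.lookup (scale c u) p) (f p))"
    by (rule extend_linear_superset) (simp_all add: keys_scale_subset)
  then show ?thesis by (simp add: extend_linear_def scale_sum)
qed

lemma extend_linear_diff: "extend_linear f (u - v) = extend_linear f u - extend_linear f v"
  using extend_linear_add[of f "u - v" v] by simp

lemma extend_linear_plus_fun:
  "extend_linear (\<lambda>p. f p + g p) u = extend_linear f u + extend_linear g u"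
  by (simp add: extend_linear_def scale_add sum.distrib)

lemma extend_linear_scale_fun:
  "extend_linear (\<lambda>p. scale c (f p)) u = scale c (extend_linear f u)"
  by (simp add: extend_linear_def scale_sum mult.commute)

lemma keys_extend_linear:
  assumes "\<And>p. p \<in> Poly_Mapping.keys u \<Longrightarrow> Poly_Mapping.keys (f p) \<subseteq> S"
  shows "Poly_Mapping.keys (extend_linear f u) \<subseteq> S"
proof -
  have "Poly_Mapping.keys (\<Sum>p\<in>T. scale (Poly_Mapping.lookup u p) (f p)) \<subseteq> S"
    if "finite T" "T \<subseteq> Poly_Mapping.keys u" for T
    using that
  proof (induction T)
    case (insert p T)
    then show ?case
      using assms[of p] keys_scale_subset[of "Poly_Mapping.lookup u p" "f p"]
        keys_add[of "scale (Poly_Mapping.lookup u p) (f p)"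
          "\<Sum>p\<in>T. scale (Poly_Mapping.lookup u p) (f p)"]
      by auto
  qed simp
  then show ?thesis by (simp add: extend_linear_def)
qed

section \<open>Algebras over a field\<close>

text \<open>
  Unital associative algebras, commutative or not. The scalars form a type, so the axioms for
  them carry no carrier conditions.
\<close>

locale k_algebra = ring A
  for A :: "('k::field, 'a, 'm) module_scheme" (structure) +
  assumes smult_closed [simp, intro]: "a \<in> carrier A \<Longrightarrow> c \<odot> a \<in> carrier A"
    and smult_l_distr: "a \<in> carrier A \<Longrightarrow> (c + d) \<odot> a = c \<odot> a \<oplus> d \<odot> a"
    and smult_r_distr: "a \<in> carrier A \<Longrightarrow> b \<in> carrier A \<Longrightarrow> c \<odot> (a \<oplus> b) = c \<odot> a \<oplus> c \<odot> b"
    and smult_smult [simp]: "a \<in> carrier A \<Longrightarrow> c \<odot> (d \<odot> a) = (c * d) \<odot> a"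
    and smult_one [simp]: "a \<in> carrier A \<Longrightarrow> 1 \<odot> a = a"
    and smult_mult_left [simp]:
      "a \<in> carrier A \<Longrightarrow> b \<in> carrier A \<Longrightarrow> (c \<odot> a) \<otimes> b = c \<odot> (a \<otimes> b)"
    and smult_mult_right [simp]:
      "a \<in> carrier A \<Longrightarrow> b \<in> carrier A \<Longrightarrow> a \<otimes> (c \<odot> b) = c \<odot> (a \<otimes> b)"
begin

lemma smult_zero_left [simp]:
  assumes "a \<in> carrier A" shows "0 \<odot> a = \<zero>"
proof -
  have "0 \<odot> a \<oplus> 0 \<odot> a = 0 \<odot> a \<oplus> \<zero>"
    using smult_l_distr[OF assms, of 0 0] assms by simp
  then show ?thesis using assms add.r_cancel_one[of "0 \<odot> a" "0 \<odot> a"] by simp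
qed

lemma smult_zero_right [simp]: "c \<odot> \<zero> = \<zero>"
  using smult_smult[of \<zero> c 0] by simp

lemma smult_minus_one: assumes "a \<in> carrier A" shows "(- 1) \<odot> a = \<ominus> a"
proof -
  have "(- 1) \<odot> a \<oplus> a = \<zero>"
    using smult_l_distr[OF assms, of "- 1" 1] assms by simp
  then show ?thesis using assms by (metis minus_equality smult_closed)
qed

lemma smult_finsum:
  "f \<in> S \<rightarrow> carrier A \<Longrightarrow> c \<odot> finsum A f S = (\<Oplus>i\<in>S. c \<odot> f i)"
proof (induction S rule: infinite_finite_induct)
  case (insert i S)
  then have "f \<in> S \<rightarrow> carrier A" "f i \<in> carrier A" "(\<lambda>i. c \<odot> f i) \<in> S \<rightarrow> carrier A" by auto
  then show ?case using insert by (simp add: finsum_insert smult_r_distr)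
qed simp_all

lemma smult_pow:
  assumes "a \<in> carrier A" shows "(c \<odot> a) [^] (k::nat) = c ^ k \<odot> a [^] k"
  by (induction k) (simp_all add: assms mult.commute)

definition linear_combination :: "('w \<Rightarrow> 'a) \<Rightarrow> ('w \<Rightarrow>\<^sub>0 'k) \<Rightarrow> 'a" where
  "linear_combination W p =
     (\<Oplus>w\<in>Poly_Mapping.keys p. Poly_Mapping.lookup p w \<odot> W w)"

context
  fixes W :: "'w \<Rightarrow> 'a"
  assumes W: "\<And>w. W w \<in> carrier A"
begin

lemma linear_combination_superset:
  assumes "finite S" "Poly_Mapping.keys p \<subseteq> S"
  shows "linear_combination W p = (\<Oplus>w\<in>S. Poly_Mapping.lookup p w \<odot> W w)"
  unfolding linear_combination_def using assms W
  by (intro add.finprod_mono_neutral_cong_left) (auto simp: in_keys_iff)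

lemma linear_combination_closed [simp]: "linear_combination W p \<in> carrier A"
  unfolding linear_combination_def using W by (intro finsum_closed) auto

lemma linear_combination_add:
  "linear_combination W (p + r) = linear_combination W p \<oplus> linear_combination W r"
proof -
  let ?S = "Poly_Mapping.keys p \<union> Poly_Mapping.keys r"
  have S: "finite ?S" by simp
  have "(\<Oplus>w\<in>?S. Poly_Mapping.lookup (p + r) w \<odot> W w) =
      (\<Oplus>w\<in>?S. Poly_Mapping.lookup p w \<odot> W w \<oplus> Poly_Mapping.lookup r w \<odot> W w)"
    using W by (intro finsum_cong') (auto simp: lookup_add smult_l_distr)
  also have "\<dots> = (\<Oplus>w\<in>?S. Poly_Mapping.lookup p w \<odot> W w) \<oplus>
      (\<Oplus>w\<in>?S. Poly_Mapping.lookup r w \<odot> W w)"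
    using W by (intro finsum_addf) auto
  finally show ?thesis
    using linear_combination_superset[OF S, of p] linear_combination_superset[OF S, of r]
      linear_combination_superset[OF S, of "p + r"] keys_add[of p r] by simp
qed

lemma linear_combination_zero [simp]: "linear_combination W 0 = \<zero>"
  by (simp add: linear_combination_def)

lemma linear_combination_single [simp]:
  "linear_combination W (Poly_Mapping.single w c) = c \<odot> W w"
  using W[of w] linear_combination_superset[of "{w}" "Poly_Mapping.single w c"]
  by (simp add: finsum_insert)

lemma linear_combination_scale:
  "linear_combination W (scale c p) = c \<odot> linear_combination W p"
proof -
  have "linear_combination W (scale c p) =
      (\<Oplus>w\<in>Poly_Mapping.keys p. Poly_Mapping.lookup (scale c p) w \<odot> W w)"
    by (rule linear_combination_superset) (simp_all add: keys_scale_subset)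
  also have "\<dots> = (\<Oplus>w\<in>Poly_Mapping.keys p. c \<odot> (Poly_Mapping.lookup p w \<odot> W w))"
    using W by (intro finsum_cong') auto
  also have "\<dots> = c \<odot> linear_combination W p"
    unfolding linear_combination_def using W by (intro smult_finsum[symmetric]) auto
  finally show ?thesis .
qed

end

end

definition algebra_hom ::
  "('k, 'a, 'm) module_scheme \<Rightarrow> ('k, 'b, 'n) module_scheme \<Rightarrow> ('a \<Rightarrow> 'b) set" where
  "algebra_hom A B =
     {f \<in> ring_hom A B. \<forall>c. \<forall>a\<in>carrier A. f (c \<odot>\<^bsub>A\<^esub> a) = c \<odot>\<^bsub>B\<^esub> f a}"

lemma algebra_homI:
  assumes "\<And>a. a \<in> carrier A \<Longrightarrow> f a \<in> carrier B"
    and "\<And>a b. a \<in> carrier A \<Longrightarrow> b \<in> carrier A \<Longrightarrow> f (a \<otimes>\<^bsub>A\<^esub> b) = f a \<otimes>\<^bsub>B\<^esub> f b"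
    and "\<And>a b. a \<in> carrier A \<Longrightarrow> b \<in> carrier A \<Longrightarrow> f (a \<oplus>\<^bsub>A\<^esub> b) = f a \<oplus>\<^bsub>B\<^esub> f b"
    and "f \<one>\<^bsub>A\<^esub> = \<one>\<^bsub>B\<^esub>"
    and "\<And>c a. a \<in> carrier A \<Longrightarrow> f (c \<odot>\<^bsub>A\<^esub> a) = c \<odot>\<^bsub>B\<^esub> f a"
  shows "f \<in> algebra_hom A B"
  using assms by (auto simp: algebra_hom_def intro!: ring_hom_memI)

lemma algebra_homD:
  assumes "f \<in> algebra_hom A B"
  shows "a \<in> carrier A \<Longrightarrow> f a \<in> carrier B"
    and "a \<in> carrier A \<Longrightarrow> b \<in> carrier A \<Longrightarrow> f (a \<otimes>\<^bsub>A\<^esub> b) = f a \<otimes>\<^bsub>B\<^esub> f b"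
    and "a \<in> carrier A \<Longrightarrow> b \<in> carrier A \<Longrightarrow> f (a \<oplus>\<^bsub>A\<^esub> b) = f a \<oplus>\<^bsub>B\<^esub> f b"
    and "f \<one>\<^bsub>A\<^esub> = \<one>\<^bsub>B\<^esub>"
    and "a \<in> carrier A \<Longrightarrow> f (c \<odot>\<^bsub>A\<^esub> a) = c \<odot>\<^bsub>B\<^esub> f a"
  using assms by (auto simp: algebra_hom_def ring_hom_def)

lemma algebra_hom_comp:
  assumes f: "f \<in> algebra_hom A B" and g: "g \<in> algebra_hom B C"
  shows "(\<lambda>a. g (f a)) \<in> algebra_hom A C"
  by (rule algebra_homI) (simp_all add: algebra_homD[OF f] algebra_homD[OF g])

lemma algebra_hom_minus:
  assumes "k_algebra A" "k_algebra B" "f \<in> algebra_hom A B" "a \<in> carrier A"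
  shows "f (\<ominus>\<^bsub>A\<^esub> a) = \<ominus>\<^bsub>B\<^esub> f a"
proof -
  interpret A: k_algebra A by fact
  interpret B: k_algebra B by fact
  show ?thesis
    using algebra_homD(5)[OF assms(3,4), of "- 1"] algebra_homD(1)[OF assms(3,4)] assms(4)
    by (simp add: A.smult_minus_one B.smult_minus_one)
qed

lemma algebra_hom_pow:
  assumes "k_algebra A" "k_algebra B" "f \<in> algebra_hom A B" "a \<in> carrier A"
  shows "f (a [^]\<^bsub>A\<^esub> (k::nat)) = f a [^]\<^bsub>B\<^esub> k"
proof -
  interpret A: k_algebra A by fact
  interpret B: k_algebra B by fact
  show ?thesis
    by (induction k) (simp_all add: algebra_homD[OF assms(3)] assms(4))
qed

section \<open>The free algebra\<close>

lemma free_algebra_simps [simp]: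
  "carrier free_algebra = UNIV" "monoid.mult free_algebra = (*)" "one free_algebra = 1"
  "zero free_algebra = 0" "add free_algebra = (+)" "smult free_algebra = scale"
  by (simp_all add: free_algebra_def)

text \<open>
  A scalar multiple is the product with a multiple of the empty word, which is central.
\<close>

lemma scale_mult_left: "scale c u * (v :: 'k::field free) = scale c (u * v)"
  and scale_mult_right: "(u :: 'k::field free) * scale c v = scale c (u * v)"
proof -
  have *: "scale c w = Poly_Mapping.single 0 c * w" "scale c w = w * Poly_Mapping.single 0 c"
    for w :: "'k free"
  proof -
    show "scale c w = Poly_Mapping.single 0 c * w"
      by (rule linear_combination_induct[of w UNIV])
        (simp_all add: scale_add mult_single algebra_simps)
    show "scale c w = w * Poly_Mapping.single 0 c"
      by (rule linear_combination_induct[of w UNIV])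
        (simp_all add: scale_add mult_single algebra_simps)
  qed
  show "scale c u * v = scale c (u * v)" by (metis *(1) mult.assoc)
  show "u * scale c v = scale c (u * v)" by (metis *(2) mult.assoc)
qed

lemma ring_free_algebra: "ring (free_algebra :: ('k::field, 'k free) module)"
proof (rule ringI)
  show "abelian_group (free_algebra :: ('k, 'k free) module)"
    by (rule abelian_groupI) (auto intro: exI[of _ "- x" for x] simp: algebra_simps)
  show "Group.monoid (free_algebra :: ('k, 'k free) module)"
    by (rule monoidI) (simp_all add: algebra_simps)
qed (simp_all add: algebra_simps)

lemma k_algebra_free_algebra: "k_algebra (free_algebra :: ('k::field, 'k free) module)"
  by (intro k_algebra.intro k_algebra_axioms.intro ring_free_algebra)
    (simp_all add: scale_add scale_add_scalar scale_mult_left scale_mult_right)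

lemma free_algebra_pow [simp]: "(p :: 'k::field free) [^]\<^bsub>free_algebra\<^esub> (k::nat) = p ^ k"
proof -
  interpret k_algebra "free_algebra :: ('k, 'k free) module" by (rule k_algebra_free_algebra)
  show ?thesis by (induction k) (simp_all add: power_commutes)
qed

text \<open>
  A word is a product of generators, so closure under the algebra operations suffices.
\<close>

lemma free_algebra_induct [case_names one generator mult add scale]:
  fixes p :: "'k::field free"
  assumes one: "P 1"
    and generator: "\<And>y. P (free_gen y)"
    and mult: "\<And>u v. P u \<Longrightarrow> P v \<Longrightarrow> P (u * v)"
    and add: "\<And>u v. P u \<Longrightarrow> P v \<Longrightarrow> P (u + v)"
    and scale: "\<And>c u. P u \<Longrightarrow> P (scale c u)"
  shows "P p"
proof -
  have word: "P (Poly_Mapping.single w 1)" for w :: "gen list"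
  proof (induction w)
    case Nil
    have "(Poly_Mapping.single [] 1 :: 'k free) = 1"
      by (metis single_one zero_list_def)
    then show ?case by (simp add: one)
  next
    case (Cons y w)
    have "(Poly_Mapping.single (y # w) 1 :: 'k free) = free_gen y * Poly_Mapping.single w 1"
      by (simp add: free_gen_def mult_single plus_list_def)
    then show ?case by (simp add: mult generator Cons)
  qed
  show ?thesis
  proof (rule linear_combination_induct[of p UNIV])
    show "P 0" using scale[OF one, of 0] by simp
    show "P (Poly_Mapping.single w c)" for w c
      using scale[OF word[of w], of c] by simp
  qed (use add in auto)
qed

lemma algebra_hom_free_eqI:
  fixes f :: "'k::field free \<Rightarrow> 'b"
  assumes f: "f \<in> algebra_hom free_algebra B" and g: "g \<in> algebra_hom free_algebra B"
    and eq: "\<And>y. f (free_gen y) = g (free_gen y)"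
  shows "f p = g p"
proof (induction p rule: free_algebra_induct)
  case one
  show ?case using algebra_homD(4)[OF f] algebra_homD(4)[OF g] by simp
next
  case (mult u v)
  then show ?case using algebra_homD(2)[OF f, of u v] algebra_homD(2)[OF g, of u v] by simp
next
  case (add u v)
  then show ?case using algebra_homD(3)[OF f, of u v] algebra_homD(3)[OF g, of u v] by simp
next
  case (scale c u)
  then show ?case using algebra_homD(5)[OF f, of u c] algebra_homD(5)[OF g, of u c] by simp
qed (rule eq)

context k_algebra
begin

text \<open>
  The universal property of the free algebra. Words are evaluated as products, concatenation
  becomes multiplication by associativity, and bilinearity does the rest.
\<close>

lemma free_lift:
  assumes \<phi>: "\<And>y. \<phi> y \<in> carrier A"
  shows "free_lift A \<phi> \<in> algebra_hom free_algebra A"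
    and "free_lift A \<phi> (free_gen y) = \<phi> y"
proof -
  define W where "W = (\<lambda>w. foldr (\<lambda>y b. \<phi> y \<otimes> b) w \<one>)"
  have W: "W w \<in> carrier A" for w by (induction w) (simp_all add: W_def \<phi>)
  have W_append: "W (v + w) = W v \<otimes> W w" for v w
  proof (induction v)
    case Nil
    show ?case using W[of w] by (simp add: W_def plus_list_def)
  next
    case (Cons y v)
    then show ?case using W[of v] W[of w] \<phi>[of y] by (simp add: W_def plus_list_def m_assoc)
  qed
  have eq: "free_lift A \<phi> = linear_combination W"
    by (simp add: fun_eq_iff free_lift_def linear_combination_def W_def)
  note lc = linear_combination_add[of W, OF W] linear_combination_single[of W, OF W]
    linear_combination_zero[of W, OF W] linear_combination_closed[of W, OF W]
    linear_combination_scale[of W, OF W]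
  have mult: "linear_combination W (u * v) = linear_combination W u \<otimes> linear_combination W v"
    for u v
  proof (rule linear_combination_induct[of u UNIV])
    fix w c
    show "linear_combination W (Poly_Mapping.single w c * v) =
        linear_combination W (Poly_Mapping.single w c) \<otimes> linear_combination W v"
      by (rule linear_combination_induct[of v UNIV])
        (simp_all add: lc W W_append mult_single algebra_simps r_distr)
  qed (simp_all add: lc W algebra_simps l_distr)
  show "free_lift A \<phi> \<in> algebra_hom free_algebra A"
  proof (rule algebra_homI)
    have "linear_combination W (Poly_Mapping.single [] 1) = \<one>"
      using W[of "[]"] by (simp only: lc) (simp add: W_def)
    then show "free_lift A \<phi> \<one>\<^bsub>free_algebra\<^esub> = \<one>"
      by (metis eq single_one zero_list_def free_algebra_simps(3))
  qed (simp_all add: eq lc mult)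
  show "free_lift A \<phi> (free_gen y) = \<phi> y"
    using \<phi>[of y] W[of "[y]"] by (simp only: eq free_gen_def lc) (simp add: W_def)
qed

end

section \<open>Quotients of algebras\<close>

lemma quotient_algebra_simps:
  "carrier (quotient_algebra A I) = a_rcosets\<^bsub>A\<^esub> I"
  "monoid.mult (quotient_algebra A I) = rcoset_mult A I"
  "one (quotient_algebra A I) = I +>\<^bsub>A\<^esub> \<one>\<^bsub>A\<^esub>"
  "zero (quotient_algebra A I) = I"
  "add (quotient_algebra A I) = set_add A"
  "smult (quotient_algebra A I) = (\<lambda>c X. \<Union>a\<in>X. I +>\<^bsub>A\<^esub> (c \<odot>\<^bsub>A\<^esub> a))"
  by (simp_all add: quotient_algebra_def FactRing_def ring.defs module.defs)

lemma carrier_quotient_algebraE: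
  assumes "Y \<in> carrier (quotient_algebra A I)"
  obtains a where "a \<in> carrier A" "Y = I +>\<^bsub>A\<^esub> a"
  using assms by (auto simp: quotient_algebra_simps A_RCOSETS_defs a_r_coset_def r_coset_def)

context k_algebra
begin

lemma smult_ideal_closed:
  assumes "ideal I A" "a \<in> I" shows "c \<odot> a \<in> I"
proof -
  interpret ideal I A by fact
  have "(c \<odot> \<one>) \<otimes> a \<in> I" by (rule I_l_closed) (simp_all add: assms)
  then show ?thesis using a_Hcarr[OF assms(2)] by simp
qed

text \<open>
  An ideal is stable under scalars, as \<open>c a = (c 1) a\<close>, so the union that defines scalar
  multiplication on cosets consists of equal cosets.
\<close>

lemma quotient_smult:
  assumes I: "ideal I A" and a: "a \<in> carrier A"
  shows "c \<odot>\<^bsub>quotient_algebra A I\<^esub> (I +> a) = I +> (c \<odot> a)"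
proof -
  interpret ideal I A by fact
  have "I +> (c \<odot> b) = I +> (c \<odot> a)" if "b \<in> I +> a" for b
  proof -
    from that obtain i where i: "i \<in> I" "b = i \<oplus> a"
      by (auto simp: a_r_coset_def r_coset_def)
    have "c \<odot> b = c \<odot> i \<oplus> c \<odot> a" using i a a_Hcarr[OF i(1)] by (simp add: smult_r_distr)
    moreover have "c \<odot> i \<in> I" by (rule smult_ideal_closed[OF I i(1)])
    ultimately have "c \<odot> b \<in> I +> (c \<odot> a)" by (auto simp: a_r_coset_def r_coset_def)
    then show ?thesis using a by (metis a_repr_independence a_subgroup smult_closed)
  qed
  moreover have "a \<in> I +> a" using a by (rule a_rcos_self)
  ultimately have "(\<Union>b\<in>I +> a. I +> (c \<odot> b)) = I +> (c \<odot> a)" by blast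
  then show ?thesis by (simp add: quotient_algebra_simps)
qed

lemma k_algebra_quotient:
  assumes I: "ideal I A"
  shows "k_algebra (quotient_algebra A I)"
    and "(+>) I \<in> algebra_hom A (quotient_algebra A I)"
proof -
  interpret ideal I A by fact
  let ?Q = "quotient_algebra A I"
  interpret R: ring "A Quot I" by (rule quotient_is_ring)
  have eqs: "carrier ?Q = carrier (A Quot I)" "monoid.mult ?Q = monoid.mult (A Quot I)"
    "one ?Q = one (A Quot I)" "zero ?Q = zero (A Quot I)" "add ?Q = add (A Quot I)"
    by (simp_all add: quotient_algebra_simps FactRing_def)
  have ring: "ring ?Q"
  proof (rule ringI)
    show "abelian_group ?Q"
    proof (rule abelian_groupI)
      show "\<exists>Z\<in>carrier ?Q. Z \<oplus>\<^bsub>?Q\<^esub> Y = \<zero>\<^bsub>?Q\<^esub>" if "Y \<in> carrier ?Q" for Y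
        using that R.l_neg R.a_inv_closed by (metis eqs)
    qed (simp_all add: eqs R.a_ac)
    show "Group.monoid ?Q"
      by (rule monoidI) (simp_all add: eqs R.m_assoc)
  qed (simp_all add: eqs R.l_distr R.r_distr)
  have closed: "I +> a \<in> carrier ?Q" if "a \<in> carrier A" for a
    using that by (simp add: quotient_algebra_simps a_rcosetsI a_subset)
  have mult: "(I +> a) \<otimes>\<^bsub>?Q\<^esub> (I +> b) = I +> (a \<otimes> b)"
    and add: "(I +> a) \<oplus>\<^bsub>?Q\<^esub> (I +> b) = I +> (a \<oplus> b)"
    if "a \<in> carrier A" "b \<in> carrier A" for a b
    using that by (simp_all add: quotient_algebra_simps rcoset_mult_add a_rcos_sum)
  note smult = quotient_smult[OF I]
  show "k_algebra ?Q"
    by (intro k_algebra.intro k_algebra_axioms.intro ring;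
        (elim carrier_quotient_algebraE)?;
        simp add: closed mult add smult smult_l_distr smult_r_distr)
  show "(+>) I \<in> algebra_hom A ?Q"
    by (rule algebra_homI) (simp_all add: closed mult add smult, simp add: quotient_algebra_simps)
qed

text \<open>
  This is what makes a map defined by \<^const>\<open>the_elem\<close> on a coset well defined: on the coset of \<open>a\<close>
  it has the value \<open>F a\<close>.
\<close>

lemma image_coset:
  assumes I: "ideal I A" and B: "k_algebra B" and F: "F \<in> algebra_hom A B"
    and kills: "\<And>i. i \<in> I \<Longrightarrow> F i = \<zero>\<^bsub>B\<^esub>" and a: "a \<in> carrier A"
  shows "F ` (I +> a) = {F a}"
proof -
  interpret ideal I A by fact
  interpret B: k_algebra B by fact
  have "F (i \<oplus> a) = F a" if "i \<in> I" for i
    using kills[OF that] a_Hcarr[OF that] a algebra_homD(1,3)[OF F] by simp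
  then have "\<forall>b\<in>I +> a. F b = F a" by (auto simp: a_r_coset_def r_coset_def)
  moreover have "a \<in> I +> a" using a by (rule a_rcos_self)
  ultimately show ?thesis by blast
qed

lemma algebra_hom_quotient:
  assumes I: "ideal I A" and B: "k_algebra B" and F: "F \<in> algebra_hom A B"
    and kills: "\<And>i. i \<in> I \<Longrightarrow> F i = \<zero>\<^bsub>B\<^esub>"
  shows "(\<lambda>Y. the_elem (F ` Y)) \<in> algebra_hom (quotient_algebra A I) B"
proof -
  note image = image_coset[OF assms]
  note Q = algebra_homD(2-5)[OF k_algebra_quotient(2)[OF I], symmetric]
  show ?thesis
    by (rule algebra_homI; (elim carrier_quotient_algebraE)?;
        simp add: image Q algebra_homD[OF F] del: r_one l_one)
qed

end

section \<open>Opposite algebras\<close>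

lemma opposite_algebra_simps [simp]:
  "carrier (opposite_algebra A) = carrier A"
  "a \<otimes>\<^bsub>opposite_algebra A\<^esub> b = b \<otimes>\<^bsub>A\<^esub> a"
  "one (opposite_algebra A) = one A" "zero (opposite_algebra A) = zero A"
  "add (opposite_algebra A) = add A" "smult (opposite_algebra A) = smult A"
  by (simp_all add: opposite_algebra_def)

text \<open>
  The opposite algebra turns the antipode, which reverses products, into an algebra map.
\<close>

lemma k_algebra_opposite:
  assumes "k_algebra A" shows "k_algebra (opposite_algebra A)"
proof -
  interpret k_algebra A by fact
  have "ring (opposite_algebra A)"
  proof (rule ringI)
    show "abelian_group (opposite_algebra A)"
      by (rule comm_group_abelian_groupI) (use a_comm_group in simp)
    show "Group.monoid (opposite_algebra A)"
      by (rule monoidI) (simp_all add: m_assoc)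
  qed (simp_all add: l_distr r_distr)
  then show ?thesis
    by (intro k_algebra.intro k_algebra_axioms.intro) (simp_all add: smult_l_distr smult_r_distr)
qed

lemma opposite_algebra_pow:
  assumes "k_algebra A" "a \<in> carrier A"
  shows "a [^]\<^bsub>opposite_algebra A\<^esub> (k::nat) = a [^]\<^bsub>A\<^esub> k"
proof -
  interpret k_algebra A by fact
  interpret O: k_algebra "opposite_algebra A" by (rule k_algebra_opposite) fact
  show ?thesis using assms(2)
  proof (induction k)
    case (Suc k)
    then show ?case using O.nat_pow_Suc2[of a k] by simp
  qed simp
qed

lemma algebra_hom_opposite:
  "f \<in> algebra_hom A B \<Longrightarrow> f \<in> algebra_hom (opposite_algebra A) (opposite_algebra B)"
  by (rule algebra_homI) (simp_all add: algebra_homD)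

section \<open>The algebras \<open>T\<close> by generators and relations\<close>

text \<open>
  The relations are stated for three elements of an arbitrary algebra. The structure
  maps of \<open>T\<close>, the twists and the extensions of characters all arise by exhibiting such elements.
\<close>

definition satisfies_T_relations ::
  "nat \<Rightarrow> nat \<Rightarrow> 'k::field \<Rightarrow> 'k \<Rightarrow> ('k, 'b, 'm) module_scheme \<Rightarrow> (gen \<Rightarrow> 'b) \<Rightarrow> bool" where
  "satisfies_T_relations n m q \<omega> B \<phi> \<longleftrightarrow>
     (\<forall>y. \<phi> y \<in> carrier B) \<and>
     \<phi> Gen_g [^]\<^bsub>B\<^esub> n = \<one>\<^bsub>B\<^esub> \<and> \<phi> Gen_h [^]\<^bsub>B\<^esub> m = \<one>\<^bsub>B\<^esub> \<and> \<phi> Gen_x [^]\<^bsub>B\<^esub> m = \<zero>\<^bsub>B\<^esub> \<and>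
     \<phi> Gen_x \<otimes>\<^bsub>B\<^esub> \<phi> Gen_h = q \<odot>\<^bsub>B\<^esub> (\<phi> Gen_h \<otimes>\<^bsub>B\<^esub> \<phi> Gen_x) \<and>
     \<phi> Gen_h \<otimes>\<^bsub>B\<^esub> \<phi> Gen_g = \<phi> Gen_g \<otimes>\<^bsub>B\<^esub> \<phi> Gen_h \<and>
     \<phi> Gen_g \<otimes>\<^bsub>B\<^esub> \<phi> Gen_x = \<omega> \<odot>\<^bsub>B\<^esub> (\<phi> Gen_x \<otimes>\<^bsub>B\<^esub> \<phi> Gen_g)"

lemma algebra_hom_free_diff:
  assumes B: "k_algebra B" and F: "F \<in> algebra_hom free_algebra B"
  shows "F (p - r) = F p \<ominus>\<^bsub>B\<^esub> F r"
proof -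
  interpret B: k_algebra B by fact
  have "F (p + scale (- 1) r) = F p \<oplus>\<^bsub>B\<^esub> F (scale (- 1) r)"
    using algebra_homD(3)[OF F, of p "scale (- 1) r"] by simp
  then have "F (p - r) = F p \<oplus>\<^bsub>B\<^esub> F (scale (- 1) r)"
    by (simp add: scale_minus_one)
  also have "F (scale (- 1) r) = \<ominus>\<^bsub>B\<^esub> F r"
    using algebra_homD(1,5)[OF F, of r] by (simp add: B.smult_minus_one)
  finally show ?thesis by (simp add: a_minus_def)
qed

lemma satisfies_T_relations_iff_kills:
  fixes q \<omega> :: "'k::field"
  assumes B: "k_algebra B" and F: "F \<in> algebra_hom free_algebra B"
  shows "satisfies_T_relations n m q \<omega> B (\<lambda>y. F (free_gen y)) \<longleftrightarrow>
    (\<forall>r\<in>T_relations n m q \<omega>. F r = \<zero>\<^bsub>B\<^esub>)"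
proof -
  interpret B: k_algebra B by fact
  have closed: "F p \<in> carrier B" for p using algebra_homD(1)[OF F] by simp
  have F': "F (p * r) = F p \<otimes>\<^bsub>B\<^esub> F r" "F (scale c p) = c \<odot>\<^bsub>B\<^esub> F p" "F 1 = \<one>\<^bsub>B\<^esub>"
    "F (p ^ k) = F p [^]\<^bsub>B\<^esub> k" for p r c k
    using algebra_homD(2)[OF F, of p r] algebra_homD(5)[OF F, of p c] algebra_homD(4)[OF F]
      algebra_hom_pow[OF k_algebra_free_algebra B F, of p k] by simp_all
  have diff: "a \<ominus>\<^bsub>B\<^esub> b = \<zero>\<^bsub>B\<^esub> \<longleftrightarrow> a = b" if "a \<in> carrier B" "b \<in> carrier B" for a b
    using that B.r_neg B.add.inv_equality[of a "\<ominus>\<^bsub>B\<^esub> b"] by (auto simp: a_minus_def)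
  show ?thesis
    by (simp add: satisfies_T_relations_def T_relations_def Let_def closed F' diff
        algebra_hom_free_diff[OF B F])
qed

lemma ideal_T_ideal: "ideal (T_ideal n m q \<omega>) (free_algebra :: ('k::field, 'k free) module)"
  unfolding T_ideal_def by (rule ring.genideal_ideal[OF ring_free_algebra]) simp

lemma T_relations_subset: "T_relations n m q \<omega> \<subseteq> T_ideal n m q \<omega>"
  unfolding T_ideal_def by (rule ring.genideal_self[OF ring_free_algebra]) simp

lemma k_algebra_T: "k_algebra (T_algebra n m q \<omega>)"
  and T_coset_hom: "(+>\<^bsub>free_algebra\<^esub>) (T_ideal n m q \<omega>) \<in> algebra_hom free_algebra (T_algebra n m q \<omega>)"
  unfolding T_algebra_def
  by (rule k_algebra.k_algebra_quotient[OF k_algebra_free_algebra ideal_T_ideal])+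

lemma T_gen_closed [simp]: "T_gen n m q \<omega> y \<in> carrier (T_algebra n m q \<omega>)"
  unfolding T_gen_def using algebra_homD(1)[OF T_coset_hom] by simp

lemma carrier_T_E:
  assumes "Y \<in> carrier (T_algebra n m q \<omega>)"
  obtains p where "Y = T_ideal n m q \<omega> +>\<^bsub>free_algebra\<^esub> p"
  using assms unfolding T_algebra_def by (auto elim: carrier_quotient_algebraE)

lemma T_satisfies_relations:
  fixes q \<omega> :: "'k::field"
  shows "satisfies_T_relations n m q \<omega> (T_algebra n m q \<omega>) (T_gen n m q \<omega>)"
proof -
  interpret ideal "T_ideal n m q \<omega>" "free_algebra :: ('k, 'k free) module" by (rule ideal_T_ideal)
  have "T_ideal n m q \<omega> +>\<^bsub>free_algebra\<^esub> r = \<zero>\<^bsub>T_algebra n m q \<omega>\<^esub>" if "r \<in> T_relations n m q \<omega>" for r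
    using that T_relations_subset[of n m q \<omega>] a_rcos_const
    by (auto simp: T_algebra_def quotient_algebra_simps)
  then show ?thesis
    using satisfies_T_relations_iff_kills[OF k_algebra_T T_coset_hom, of n m q \<omega> n m q \<omega>]
    unfolding T_gen_def by blast
qed

lemma T_hom_eqI:
  assumes f: "f \<in> algebra_hom (T_algebra n m q \<omega>) B" and g: "g \<in> algebra_hom (T_algebra n m q \<omega>) B"
    and eq: "\<And>y. f (T_gen n m q \<omega> y) = g (T_gen n m q \<omega> y)"
    and Y: "Y \<in> carrier (T_algebra n m q \<omega>)"
  shows "f Y = g Y"
proof -
  from Y obtain p where p: "Y = T_ideal n m q \<omega> +>\<^bsub>free_algebra\<^esub> p" by (rule carrier_T_E)
  show ?thesis unfolding p
    by (rule algebra_hom_free_eqI[OF algebra_hom_comp[OF T_coset_hom f] algebra_hom_comp[OF T_coset_hom g]])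
      (use eq in \<open>simp add: T_gen_def\<close>)
qed

text \<open>
  The kernel of the lift to the free algebra is an ideal that contains the relations.
\<close>

lemma T_universal_property:
  fixes q \<omega> :: "'k::field"
  assumes B: "k_algebra B" and rel: "satisfies_T_relations n m q \<omega> B \<phi>"
  defines "f \<equiv> \<lambda>Y. the_elem (free_lift B \<phi> ` Y)"
  shows "f \<in> algebra_hom (T_algebra n m q \<omega>) B" and "f (T_gen n m q \<omega> y) = \<phi> y"
proof -
  interpret B: k_algebra B by fact
  have \<phi>: "\<phi> y \<in> carrier B" for y using rel by (simp add: satisfies_T_relations_def)
  note F = B.free_lift(1)[of \<phi>, OF \<phi>] and F_gen = B.free_lift(2)[of \<phi>, OF \<phi>]
  have "\<forall>r\<in>T_relations n m q \<omega>. free_lift B \<phi> r = \<zero>\<^bsub>B\<^esub>"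
    using satisfies_T_relations_iff_kills[OF B F, of n m q \<omega>] rel by (simp add: F_gen)
  moreover have "ideal (a_kernel free_algebra B (free_lift B \<phi>)) free_algebra"
    using F ring_free_algebra B.ring_axioms
    by (intro ring_hom_ring.kernel_is_ideal ring_hom_ringI2) (auto simp: algebra_hom_def)
  ultimately have "T_ideal n m q \<omega> \<subseteq> a_kernel free_algebra B (free_lift B \<phi>)"
    unfolding T_ideal_def
    by (intro ring.genideal_minimal[OF ring_free_algebra]) (auto simp: a_kernel_def')
  then have kills: "free_lift B \<phi> i = \<zero>\<^bsub>B\<^esub>" if "i \<in> T_ideal n m q \<omega>" for i
    using that by (auto simp: a_kernel_def')
  show "f \<in> algebra_hom (T_algebra n m q \<omega>) B"
    unfolding f_def T_algebra_def
    by (rule k_algebra.algebra_hom_quotient[OF k_algebra_free_algebra ideal_T_ideal B F kills])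
  show "f (T_gen n m q \<omega> y) = \<phi> y"
    using k_algebra.image_coset[OF k_algebra_free_algebra ideal_T_ideal B F kills, where a = "free_gen y"]
    by (simp add: f_def T_gen_def F_gen)
qed

section \<open>Tensor products of algebras\<close>

text \<open>
  The double sum over supports is a linear extension in each variable, which gives bilinearity
  without a case distinction on how supports overlap.
\<close>

lemma formal_mult_extend_linear:
  "formal_mult A B u v =
     extend_linear (\<lambda>(a, b). extend_linear (\<lambda>(c, d). formal_tensor (a \<otimes>\<^bsub>A\<^esub> c) (b \<otimes>\<^bsub>B\<^esub> d)) v) u"
  unfolding formal_mult_def extend_linear_def
  by (simp add: case_prod_unfold scale_sum del: scale_simps(5))

lemma formal_mult_linear_left:
  "formal_mult A B 0 v = 0"
  "formal_mult A B (u + u') v = formal_mult A B u v + formal_mult A B u' v"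
  "formal_mult A B (u - u') v = formal_mult A B u v - formal_mult A B u' v"
  "formal_mult A B (scale c u) v = scale c (formal_mult A B u v)"
  by (simp_all add: formal_mult_extend_linear extend_linear_add extend_linear_diff
      extend_linear_scale)

lemma formal_mult_linear_right:
  shows formal_mult_zero_right: "formal_mult A B u 0 = 0"
    and formal_mult_add_right:
      "formal_mult A B u (v + v') = formal_mult A B u v + formal_mult A B u v'"
    and formal_mult_scale_right: "formal_mult A B u (scale c v) = scale c (formal_mult A B u v)"
proof -
  show "formal_mult A B u 0 = 0"
    by (simp add: formal_mult_extend_linear extend_linear_def)
  have "(\<lambda>(a, b). extend_linear (\<lambda>(c, d). formal_tensor (a \<otimes>\<^bsub>A\<^esub> c) (b \<otimes>\<^bsub>B\<^esub> d)) (v + v')) =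
    (\<lambda>p. (\<lambda>(a, b). extend_linear (\<lambda>(c, d). formal_tensor (a \<otimes>\<^bsub>A\<^esub> c) (b \<otimes>\<^bsub>B\<^esub> d)) v) p +
      (\<lambda>(a, b). extend_linear (\<lambda>(c, d). formal_tensor (a \<otimes>\<^bsub>A\<^esub> c) (b \<otimes>\<^bsub>B\<^esub> d)) v') p)"
    by (simp add: fun_eq_iff extend_linear_add)
  then show "formal_mult A B u (v + v') = formal_mult A B u v + formal_mult A B u v'"
    unfolding formal_mult_extend_linear by (simp only: extend_linear_plus_fun)
  have "(\<lambda>(a, b). extend_linear (\<lambda>(c, d). formal_tensor (a \<otimes>\<^bsub>A\<^esub> c) (b \<otimes>\<^bsub>B\<^esub> d)) (scale c v)) =
    (\<lambda>p. scale c ((\<lambda>(a, b). extend_linear (\<lambda>(c, d). formal_tensor (a \<otimes>\<^bsub>A\<^esub> c) (b \<otimes>\<^bsub>B\<^esub> d)) v) p))"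
    by (simp add: fun_eq_iff extend_linear_scale)
  then show "formal_mult A B u (scale c v) = scale c (formal_mult A B u v)"
    unfolding formal_mult_extend_linear by (simp only: extend_linear_scale_fun)
qed

lemma formal_mult_diff_right:
  "formal_mult A B u (v - v') = formal_mult A B u v - formal_mult A B u v'"
  using formal_mult_add_right[of A B u "v - v'" v'] by simp

lemma formal_mult_single:
  "formal_mult A B (Poly_Mapping.single (a, b) k) (Poly_Mapping.single (c, d) l) =
     Poly_Mapping.single (a \<otimes>\<^bsub>A\<^esub> c, b \<otimes>\<^bsub>B\<^esub> d) (k * l)"
  by (simp add: formal_mult_extend_linear)

lemmas formal_mult_simps = formal_mult_linear_left formal_mult_linear_right
  formal_mult_diff_right formal_mult_single

locale algebra_pair = A: k_algebra A + B: k_algebra B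
  for A :: "('k::field, 'a, 'm) module_scheme" and B :: "('k, 'b, 'n) module_scheme"
begin

abbreviation formal_combinations :: "(('a \<times> 'b) \<Rightarrow>\<^sub>0 'k) set" where
  "formal_combinations \<equiv> {u. Poly_Mapping.keys u \<subseteq> carrier A \<times> carrier B}"

lemma keys_tensor_null:
  "u \<in> tensor_null A B \<Longrightarrow> Poly_Mapping.keys u \<subseteq> carrier A \<times> carrier B"
  by (induction rule: tensor_null.induct)
    (simp_all add: keys_plus keys_minus keys_scale del: scale_simps(5))

lemma keys_formal_mult:
  assumes "u \<in> formal_combinations" "v \<in> formal_combinations"
  shows "formal_mult A B u v \<in> formal_combinations"
proof -
  have inner: "Poly_Mapping.keys
      (extend_linear (\<lambda>(c, d). formal_tensor (a \<otimes>\<^bsub>A\<^esub> c) (b \<otimes>\<^bsub>B\<^esub> d) :: _ \<Rightarrow>\<^sub>0 'k) v) \<subseteq> carrier A \<times> carrier B"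
    if "(a, b) \<in> Poly_Mapping.keys u" for a b
  proof -
    have "a \<in> carrier A" "b \<in> carrier B" using assms(1) that by auto
    then show ?thesis using assms(2) by (intro keys_extend_linear) auto
  qed
  show ?thesis
    unfolding formal_mult_extend_linear mem_Collect_eq
    by (rule keys_extend_linear, unfold split_paired_all split_conv, rule inner)
qed

lemma tensor_null_uminus: "u \<in> tensor_null A B \<Longrightarrow> - u \<in> tensor_null A B"
  using tensor_null.scale[of u A B "- 1"] by (simp add: scale_minus_one)

lemma tensor_null_diff:
  "u \<in> tensor_null A B \<Longrightarrow> v \<in> tensor_null A B \<Longrightarrow> u - v \<in> tensor_null A B"
  using tensor_null.add[of u A B "- v"] by (simp add: tensor_null_uminus)

lemma mem_tensor_class_iff: "w \<in> tensor_class A B u \<longleftrightarrow> w - u \<in> tensor_null A B"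
  unfolding tensor_class_def by (auto intro: image_eqI[of _ _ "w - u"])

lemma tensor_class_eq_iff: "tensor_class A B u = tensor_class A B v \<longleftrightarrow> u - v \<in> tensor_null A B"
proof
  assume "tensor_class A B u = tensor_class A B v"
  then show "u - v \<in> tensor_null A B"
    using mem_tensor_class_iff[of u u] mem_tensor_class_iff[of u v] by (simp add: tensor_null.zero)
next
  assume uv: "u - v \<in> tensor_null A B"
  have "w - u \<in> tensor_null A B \<longleftrightarrow> w - v \<in> tensor_null A B" for w
    using tensor_null.add[OF _ uv, of "w - u"] tensor_null_diff[OF _ uv, of "w - v"] by auto
  then show "tensor_class A B u = tensor_class A B v" by (auto simp: mem_tensor_class_iff)
qed

text \<open>
  Multiplication by a fixed element of \<open>A\<close> or \<open>B\<close> is linear and so maps each bilinearity relation to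
  one of the same kind. With the mirror image below, the null space is a two-sided ideal among the
  combinations supported on the carriers, and the product descends to classes.
\<close>

lemma tensor_null_mult_left:
  assumes u: "u \<in> tensor_null A B" and v: "v \<in> formal_combinations"
  shows "formal_mult A B u v \<in> tensor_null A B"
proof -
  have "formal_mult A B u (Poly_Mapping.single (c, d) 1) \<in> tensor_null A B"
    if cd: "c \<in> carrier A" "d \<in> carrier B" for c d
    using u
  proof (induction)
    case (add_left a a' b)
    then show ?case
      using tensor_null.add_left[of "a \<otimes>\<^bsub>A\<^esub> c" A "a' \<otimes>\<^bsub>A\<^esub> c" "b \<otimes>\<^bsub>B\<^esub> d" B] cd
      by (simp add: formal_mult_simps A.l_distr)
  next
    case (add_right a b b')
    then show ?case
      using tensor_null.add_right[of "a \<otimes>\<^bsub>A\<^esub> c" A "b \<otimes>\<^bsub>B\<^esub> d" B "b' \<otimes>\<^bsub>B\<^esub> d"] cd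
      by (simp add: formal_mult_simps B.l_distr)
  next
    case (smult_left a b k)
    then show ?case
      using tensor_null.smult_left[of "a \<otimes>\<^bsub>A\<^esub> c" A "b \<otimes>\<^bsub>B\<^esub> d" B k] cd
      by (simp add: formal_mult_simps)
  next
    case (smult_right a b k)
    then show ?case
      using tensor_null.smult_right[of "a \<otimes>\<^bsub>A\<^esub> c" A "b \<otimes>\<^bsub>B\<^esub> d" B k] cd
      by (simp add: formal_mult_simps)
  qed (simp_all add: formal_mult_simps tensor_null.intros)
  then have single: "formal_mult A B u (Poly_Mapping.single p k) \<in> tensor_null A B"
    if "p \<in> carrier A \<times> carrier B" for p k
    using that tensor_null.scale[of "formal_mult A B u (Poly_Mapping.single p 1)" A B k]
    by (auto simp: formal_mult_scale_right[symmetric])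
  from v have "Poly_Mapping.keys v \<subseteq> carrier A \<times> carrier B" by simp
  then show ?thesis
    by (induction rule: linear_combination_induct)
      (simp_all add: formal_mult_simps tensor_null.intros single)
qed

lemma tensor_null_mult_right:
  assumes u: "u \<in> tensor_null A B" and v: "v \<in> formal_combinations"
  shows "formal_mult A B v u \<in> tensor_null A B"
proof -
  have "formal_mult A B (Poly_Mapping.single (c, d) 1) u \<in> tensor_null A B"
    if cd: "c \<in> carrier A" "d \<in> carrier B" for c d
    using u
  proof (induction)
    case (add_left a a' b)
    then show ?case
      using tensor_null.add_left[of "c \<otimes>\<^bsub>A\<^esub> a" A "c \<otimes>\<^bsub>A\<^esub> a'" "d \<otimes>\<^bsub>B\<^esub> b" B] cd
      by (simp add: formal_mult_simps A.r_distr)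
  next
    case (add_right a b b')
    then show ?case
      using tensor_null.add_right[of "c \<otimes>\<^bsub>A\<^esub> a" A "d \<otimes>\<^bsub>B\<^esub> b" B "d \<otimes>\<^bsub>B\<^esub> b'"] cd
      by (simp add: formal_mult_simps B.r_distr)
  next
    case (smult_left a b k)
    then show ?case
      using tensor_null.smult_left[of "c \<otimes>\<^bsub>A\<^esub> a" A "d \<otimes>\<^bsub>B\<^esub> b" B k] cd
      by (simp add: formal_mult_simps)
  next
    case (smult_right a b k)
    then show ?case
      using tensor_null.smult_right[of "c \<otimes>\<^bsub>A\<^esub> a" A "d \<otimes>\<^bsub>B\<^esub> b" B k] cd
      by (simp add: formal_mult_simps)
  qed (simp_all add: formal_mult_simps tensor_null.intros)
  then have single: "formal_mult A B (Poly_Mapping.single p k) u \<in> tensor_null A B"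
    if "p \<in> carrier A \<times> carrier B" for p k
    using that tensor_null.scale[of "formal_mult A B (Poly_Mapping.single p 1) u" A B k]
    by (auto simp: formal_mult_linear_left(4)[symmetric])
  from v have "Poly_Mapping.keys v \<subseteq> carrier A \<times> carrier B" by simp
  then show ?thesis
    by (induction rule: linear_combination_induct)
      (simp_all add: formal_mult_simps tensor_null.intros single)
qed

text \<open>
  The identity \<open>u'v' - uv = (u' - u)v' + u(v' - v)\<close> shows that the class of the product
  depends only on the classes of the factors.
\<close>

lemma tensor_mult_class:
  assumes u: "u \<in> formal_combinations" and v: "v \<in> formal_combinations"
  shows "tensor_class A B u \<otimes>\<^bsub>tensor_algebra A B\<^esub> tensor_class A B v =
    tensor_class A B (formal_mult A B u v)"
proof -
  have "tensor_class A B (formal_mult A B u' v') = tensor_class A B (formal_mult A B u v)"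
    if "u' \<in> tensor_class A B u" "v' \<in> tensor_class A B v" for u' v'
  proof -
    from that have null: "u' - u \<in> tensor_null A B" "v' - v \<in> tensor_null A B"
      by (simp_all add: mem_tensor_class_iff)
    then have "v' \<in> formal_combinations"
      using keys_plus[OF keys_tensor_null[OF null(2)], of v] v by simp
    then have "formal_mult A B (u' - u) v' + formal_mult A B u (v' - v) \<in> tensor_null A B"
      using null u by (intro tensor_null.add tensor_null_mult_left tensor_null_mult_right)
    then show ?thesis
      by (simp add: tensor_class_eq_iff formal_mult_simps)
  qed
  moreover have "u \<in> tensor_class A B u" "v \<in> tensor_class A B v"
    by (simp_all add: mem_tensor_class_iff tensor_null.zero)
  ultimately have "(\<Union>u'\<in>tensor_class A B u. \<Union>v'\<in>tensor_class A B v. tensor_class A B (formal_mult A B u' v')) =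
      tensor_class A B (formal_mult A B u v)"
    by blast
  then show ?thesis by (simp add: tensor_algebra_def)
qed

lemma tensor_add_class:
  "tensor_class A B u \<oplus>\<^bsub>tensor_algebra A B\<^esub> tensor_class A B v = tensor_class A B (u + v)"
proof -
  have "tensor_class A B (u' + v') = tensor_class A B (u + v)"
    if "u' \<in> tensor_class A B u" "v' \<in> tensor_class A B v" for u' v'
    using that tensor_null.add[of "u' - u" A B "v' - v"]
    by (simp add: mem_tensor_class_iff tensor_class_eq_iff algebra_simps)
  moreover have "u \<in> tensor_class A B u" "v \<in> tensor_class A B v"
    by (simp_all add: mem_tensor_class_iff tensor_null.zero)
  ultimately have "(\<Union>u'\<in>tensor_class A B u. \<Union>v'\<in>tensor_class A B v. tensor_class A B (u' + v')) =
      tensor_class A B (u + v)"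
    by blast
  then show ?thesis by (simp add: tensor_algebra_def)
qed

lemma tensor_smult_class:
  "c \<odot>\<^bsub>tensor_algebra A B\<^esub> tensor_class A B u = tensor_class A B (scale c u)"
proof -
  have "tensor_class A B (scale c u') = tensor_class A B (scale c u)"
    if "u' \<in> tensor_class A B u" for u'
    using that tensor_null.scale[of "u' - u" A B c]
    by (simp add: mem_tensor_class_iff tensor_class_eq_iff scale_diff)
  moreover have "u \<in> tensor_class A B u"
    by (simp add: mem_tensor_class_iff tensor_null.zero)
  ultimately have "(\<Union>u'\<in>tensor_class A B u. tensor_class A B (scale c u')) = tensor_class A B (scale c u)"
    by blast
  then show ?thesis by (simp add: tensor_algebra_def)
qed

lemma carrier_tensor_algebra:
  "carrier (tensor_algebra A B) = tensor_class A B ` formal_combinations"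
  by (simp add: tensor_algebra_def)

lemma tensor_zero_one:
  "\<zero>\<^bsub>tensor_algebra A B\<^esub> = tensor_class A B 0"
  "\<one>\<^bsub>tensor_algebra A B\<^esub> = tensor_class A B (formal_tensor \<one>\<^bsub>A\<^esub> \<one>\<^bsub>B\<^esub>)"
  by (simp_all add: tensor_algebra_def pure_tensor_def)

lemma formal_mult_assoc:
  assumes "u \<in> formal_combinations" "v \<in> formal_combinations" "w \<in> formal_combinations"
  shows "formal_mult A B (formal_mult A B u v) w = formal_mult A B u (formal_mult A B v w)"
proof -
  have keys: "Poly_Mapping.keys u \<subseteq> carrier A \<times> carrier B"
    "Poly_Mapping.keys v \<subseteq> carrier A \<times> carrier B" "Poly_Mapping.keys w \<subseteq> carrier A \<times> carrier B"
    using assms by simp_all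
  from keys(1) show ?thesis
  proof (induction rule: linear_combination_induct)
    case (single p k)
    from keys(2) show ?case
    proof (induction rule: linear_combination_induct)
      case (single p' k')
      from keys(3) show ?case
      proof (induction rule: linear_combination_induct)
        case (single p'' k'')
        then show ?case using \<open>p \<in> _\<close> \<open>p' \<in> _\<close>
          by (auto simp: formal_mult_simps A.m_assoc B.m_assoc mult.assoc)
      qed (simp_all add: formal_mult_simps)
    qed (simp_all add: formal_mult_simps)
  qed (simp_all add: formal_mult_simps)
qed

lemma formal_mult_one:
  assumes "u \<in> formal_combinations"
  shows "formal_mult A B (formal_tensor \<one>\<^bsub>A\<^esub> \<one>\<^bsub>B\<^esub>) u = u"
    and "formal_mult A B u (formal_tensor \<one>\<^bsub>A\<^esub> \<one>\<^bsub>B\<^esub>) = u"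
proof -
  have keys: "Poly_Mapping.keys u \<subseteq> carrier A \<times> carrier B" using assms by simp
  then show "formal_mult A B (formal_tensor \<one>\<^bsub>A\<^esub> \<one>\<^bsub>B\<^esub>) u = u"
    by (induction rule: linear_combination_induct) (auto simp: formal_mult_simps)
  from keys show "formal_mult A B u (formal_tensor \<one>\<^bsub>A\<^esub> \<one>\<^bsub>B\<^esub>) = u"
    by (induction rule: linear_combination_induct) (auto simp: formal_mult_simps)
qed

lemma k_algebra_tensor_algebra: "k_algebra (tensor_algebra A B)"
proof -
  let ?T = "tensor_algebra A B"
  note ops = tensor_mult_class tensor_add_class tensor_smult_class tensor_zero_one
  have closed [simp]:
    "tensor_class A B u \<in> carrier ?T" if "u \<in> formal_combinations" for u
    using that by (simp add: carrier_tensor_algebra)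
  have rep: "\<exists>u\<in>formal_combinations. U = tensor_class A B u" if "U \<in> carrier ?T" for U
    using that by (auto simp: carrier_tensor_algebra)
  note fc = keys_plus keys_scale keys_formal_mult[simplified]
  have ring: "ring ?T"
  proof (rule ringI)
    show "abelian_group ?T"
    proof (rule abelian_groupI)
      show "\<exists>V\<in>carrier ?T. V \<oplus>\<^bsub>?T\<^esub> U = \<zero>\<^bsub>?T\<^esub>" if U: "U \<in> carrier ?T" for U
      proof -
        from rep[OF U] obtain u where u: "u \<in> formal_combinations" "U = tensor_class A B u" by blast
        then have "tensor_class A B (- u) \<in> carrier ?T" by simp
        then show ?thesis using u by (intro bexI[of _ "tensor_class A B (- u)"]) (simp_all add: ops)
      qed
    qed (auto dest!: rep simp: ops fc add_ac)
    show "Group.monoid ?T"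
      by (rule monoidI) (auto dest!: rep simp: ops fc formal_mult_assoc formal_mult_one)
  qed (auto dest!: rep simp: ops fc formal_mult_simps)
  show ?thesis
    by (intro k_algebra.intro k_algebra_axioms.intro ring)
      (auto dest!: rep simp: ops fc formal_mult_simps scale_add scale_add_scalar)
qed

lemma pure_tensor_closed [simp]:
  "a \<in> carrier A \<Longrightarrow> b \<in> carrier B \<Longrightarrow> pure_tensor A B a b \<in> carrier (tensor_algebra A B)"
  by (simp add: pure_tensor_def carrier_tensor_algebra)

lemma pure_tensor_mult:
  assumes "a \<in> carrier A" "b \<in> carrier B" "c \<in> carrier A" "d \<in> carrier B"
  shows "pure_tensor A B a b \<otimes>\<^bsub>tensor_algebra A B\<^esub> pure_tensor A B c d =
    pure_tensor A B (a \<otimes>\<^bsub>A\<^esub> c) (b \<otimes>\<^bsub>B\<^esub> d)"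
  using assms by (simp add: pure_tensor_def tensor_mult_class formal_mult_single)

lemma pure_tensor_smult_left:
  "a \<in> carrier A \<Longrightarrow> b \<in> carrier B \<Longrightarrow>
    pure_tensor A B (c \<odot>\<^bsub>A\<^esub> a) b = c \<odot>\<^bsub>tensor_algebra A B\<^esub> pure_tensor A B a b"
  using tensor_null.smult_left[of a A b B c]
  by (simp add: pure_tensor_def tensor_smult_class tensor_class_eq_iff)

lemma pure_tensor_smult_right:
  "a \<in> carrier A \<Longrightarrow> b \<in> carrier B \<Longrightarrow>
    pure_tensor A B a (c \<odot>\<^bsub>B\<^esub> b) = c \<odot>\<^bsub>tensor_algebra A B\<^esub> pure_tensor A B a b"
  using tensor_null.smult_right[of a A b B c]
  by (simp add: pure_tensor_def tensor_smult_class tensor_class_eq_iff)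

lemma pure_tensor_zero:
  shows "b \<in> carrier B \<Longrightarrow> pure_tensor A B \<zero>\<^bsub>A\<^esub> b = \<zero>\<^bsub>tensor_algebra A B\<^esub>"
    and "a \<in> carrier A \<Longrightarrow> pure_tensor A B a \<zero>\<^bsub>B\<^esub> = \<zero>\<^bsub>tensor_algebra A B\<^esub>"
proof -
  interpret T: k_algebra "tensor_algebra A B" by (rule k_algebra_tensor_algebra)
  show "pure_tensor A B \<zero>\<^bsub>A\<^esub> b = \<zero>\<^bsub>tensor_algebra A B\<^esub>" if "b \<in> carrier B"
    using pure_tensor_smult_left[of "\<zero>\<^bsub>A\<^esub>" b 0] that by simp
  show "pure_tensor A B a \<zero>\<^bsub>B\<^esub> = \<zero>\<^bsub>tensor_algebra A B\<^esub>" if "a \<in> carrier A"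
    using pure_tensor_smult_right[of a "\<zero>\<^bsub>B\<^esub>" 0] that by simp
qed

lemma pure_tensor_pow:
  assumes "a \<in> carrier A" "b \<in> carrier B"
  shows "pure_tensor A B a b [^]\<^bsub>tensor_algebra A B\<^esub> (k::nat) =
    pure_tensor A B (a [^]\<^bsub>A\<^esub> k) (b [^]\<^bsub>B\<^esub> k)"
proof -
  interpret T: k_algebra "tensor_algebra A B" by (rule k_algebra_tensor_algebra)
  show ?thesis
    by (induction k)
      (simp_all add: assms pure_tensor_mult tensor_zero_one pure_tensor_def[of _ _ "\<one>\<^bsub>A\<^esub>" "\<one>\<^bsub>B\<^esub>"])
qed

end

text \<open>
  The linear extension of \<open>f \<otimes> g\<close> preserves each bilinearity relation, and it is multiplicative on
  formal combinations over the carriers already, before passing to classes.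
\<close>

lemma tensor_map_hom:
  fixes A :: "('k::field, 'a, 'm) module_scheme" and B :: "('k, 'b, 'n) module_scheme"
    and C :: "('k, 'c, 'o) module_scheme" and D :: "('k, 'd, 'p) module_scheme"
  assumes AB: "algebra_pair A B" and CD: "algebra_pair C D"
    and f: "f \<in> algebra_hom A C" and g: "g \<in> algebra_hom B D"
  shows "tensor_map C D f g \<in> algebra_hom (tensor_algebra A B) (tensor_algebra C D)"
    and "a \<in> carrier A \<Longrightarrow> b \<in> carrier B \<Longrightarrow>
      tensor_map C D f g (pure_tensor A B a b) = pure_tensor C D (f a) (g b)"
proof -
  interpret AB: algebra_pair A B by fact
  interpret CD: algebra_pair C D by fact
  define F where "F = extend_linear (\<lambda>(a, b). formal_tensor (f a) (g b) :: _ \<Rightarrow>\<^sub>0 'k)"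
  have F: "F (Poly_Mapping.single (a, b) k) = Poly_Mapping.single (f a, g b) k"
    "F 0 = 0" "F (u + v) = F u + F v" "F (u - v) = F u - F v" "F (scale k u) = scale k (F u)"
    for a b k u v
    by (simp_all add: F_def extend_linear_add extend_linear_diff extend_linear_scale)
  note hom = algebra_homD[OF f] algebra_homD[OF g]
  have F_null: "F u \<in> tensor_null C D" if "u \<in> tensor_null A B" for u
    using that
  proof (induction)
    case (add_left a a' b)
    then show ?case using tensor_null.add_left[of "f a" C "f a'" "g b" D] by (simp add: F hom)
  next
    case (add_right a b b')
    then show ?case using tensor_null.add_right[of "f a" C "g b" D "g b'"] by (simp add: F hom)
  next
    case (smult_left a b k)
    then show ?case using tensor_null.smult_left[of "f a" C "g b" D k] by (simp add: F hom)
  next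
    case (smult_right a b k)
    then show ?case using tensor_null.smult_right[of "f a" C "g b" D k] by (simp add: F hom)
  qed (simp_all add: F tensor_null.intros)
  have map: "tensor_map C D f g (tensor_class A B u) = tensor_class C D (F u)" for u
  proof -
    have "tensor_class C D (F u') = tensor_class C D (F u)" if "u' \<in> tensor_class A B u" for u'
      using that F_null[of "u' - u"]
      by (simp add: AB.mem_tensor_class_iff CD.tensor_class_eq_iff F)
    moreover have "u \<in> tensor_class A B u"
      by (simp add: AB.mem_tensor_class_iff tensor_null.zero)
    ultimately have "(\<Union>u'\<in>tensor_class A B u. tensor_class C D (F u')) = tensor_class C D (F u)"
      by blast
    then show ?thesis
      by (simp add: tensor_map_def F_def extend_linear_def case_prod_unfold del: scale_simps(5))
  qed
  show "tensor_map C D f g (pure_tensor A B a b) = pure_tensor C D (f a) (g b)"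
    if "a \<in> carrier A" "b \<in> carrier B"
    by (simp add: pure_tensor_def map F)
  have F_closed: "Poly_Mapping.keys (F u) \<subseteq> carrier C \<times> carrier D"
    if "Poly_Mapping.keys u \<subseteq> carrier A \<times> carrier B" for u
    unfolding F_def using that by (intro keys_extend_linear) (auto simp: hom)
  have F_mult: "F (formal_mult A B u v) = formal_mult C D (F u) (F v)"
    if u: "Poly_Mapping.keys u \<subseteq> carrier A \<times> carrier B"
      and v: "Poly_Mapping.keys v \<subseteq> carrier A \<times> carrier B" for u v
    using u
  proof (induction rule: linear_combination_induct)
    case (single p k)
    from v show ?case
    proof (induction rule: linear_combination_induct)
      case (single p' k')
      then show ?case using \<open>p \<in> _\<close> by (auto simp: F formal_mult_simps hom)
    qed (simp_all add: F formal_mult_simps)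
  qed (simp_all add: F formal_mult_simps)
  show "tensor_map C D f g \<in> algebra_hom (tensor_algebra A B) (tensor_algebra C D)"
    by (rule algebra_homI)
      (auto simp: AB.carrier_tensor_algebra CD.carrier_tensor_algebra map F_closed F_mult F hom
        AB.tensor_mult_class CD.tensor_mult_class AB.tensor_add_class CD.tensor_add_class
        AB.tensor_smult_class CD.tensor_smult_class AB.tensor_zero_one CD.tensor_zero_one
        dest: F_closed[THEN subsetD])
qed

section \<open>Powers of \<open>q\<close>-commuting elements\<close>

text \<open>
  The Gaussian binomial coefficients, by their Pascal rule, so that \<open>q\<close> may be a root of unity.
\<close>

fun q_binomial :: "'k::field \<Rightarrow> nat \<Rightarrow> nat \<Rightarrow> 'k" where
  "q_binomial q n 0 = 1"
| "q_binomial q 0 (Suc k) = 0"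
| "q_binomial q (Suc n) (Suc k) = q_binomial q n k + q ^ Suc k * q_binomial q n (Suc k)"

lemma q_binomial_gt: "n < k \<Longrightarrow> q_binomial q n k = 0"
  by (induction q n k rule: q_binomial.induct) auto

text \<open>
  The division-free form of the product formula for Gaussian binomials. At \<open>q\<^bsup>n+1\<^esup> = 1\<close> the right side
  is zero, while the factor on the left is nonzero for \<open>k < n\<close> if \<open>q\<close> is primitive.
\<close>

lemma q_binomial_absorption:
  "(1 - q ^ Suc k) * q_binomial q (Suc n) (Suc k) = (1 - q ^ Suc n) * q_binomial q n k"
proof (induction n arbitrary: k)
  case 0
  then show ?case by (cases k) simp_all
next
  case (Suc n)
  show ?case
  proof (cases k)
    case 0
    have "(1 - q) * q_binomial q (Suc n) 1 = 1 - q ^ Suc n" using Suc[of 0] by simp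
    moreover have "(1 - q) * q_binomial q (Suc (Suc n)) 1 =
        1 - q + q * ((1 - q) * q_binomial q (Suc n) 1)"
      by (simp add: algebra_simps)
    ultimately have "(1 - q) * q_binomial q (Suc (Suc n)) 1 = 1 - q ^ Suc (Suc n)"
      by (simp only:) (simp add: algebra_simps)
    then show ?thesis using 0 by (simp del: q_binomial.simps(3))
  next
    case (Suc j)
    let ?b = "q_binomial q"
    have "q ^ Suc j * ((1 - q ^ Suc n) * ?b n (Suc j)) =
        (1 - q ^ Suc n) * ?b (Suc n) (Suc j) - (1 - q ^ Suc n) * ?b n j"
      by (simp add: algebra_simps)
    also have "\<dots> = (q ^ Suc j - q ^ Suc n) * ?b (Suc n) (Suc j)"
      using Suc.IH[of j] by (simp add: algebra_simps del: q_binomial.simps)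
    finally have 1: "q ^ Suc j * ((1 - q ^ Suc n) * ?b n (Suc j)) =
        (q ^ Suc j - q ^ Suc n) * ?b (Suc n) (Suc j)" .
    have "(1 - q ^ Suc (Suc j)) * ?b (Suc (Suc n)) (Suc (Suc j)) =
        (1 - q ^ Suc (Suc j)) * ?b (Suc n) (Suc j) +
        q ^ Suc (Suc j) * ((1 - q ^ Suc (Suc j)) * ?b (Suc n) (Suc (Suc j)))"
      by (subst q_binomial.simps(3)) (simp add: algebra_simps del: q_binomial.simps)
    also have "(1 - q ^ Suc (Suc j)) * ?b (Suc n) (Suc (Suc j)) =
        (1 - q ^ Suc n) * ?b n (Suc j)"
      by (rule Suc.IH)
    also have "q ^ Suc (Suc j) * ((1 - q ^ Suc n) * ?b n (Suc j)) =
        q * ((q ^ Suc j - q ^ Suc n) * ?b (Suc n) (Suc j))"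
      using 1 by (simp add: mult.assoc del: q_binomial.simps)
    finally show ?thesis unfolding Suc by (simp add: algebra_simps del: q_binomial.simps)
  qed
qed

context k_algebra
begin

lemma q_commute_pow:
  assumes "a \<in> carrier A" "b \<in> carrier A" and ba: "b \<otimes> a = c \<odot> (a \<otimes> b)"
  shows "b [^] (i::nat) \<otimes> a [^] (j::nat) = c ^ (i * j) \<odot> (a [^] j \<otimes> b [^] i)"
proof -
  have 1: "b \<otimes> a [^] j = c ^ j \<odot> (a [^] j \<otimes> b)" for j :: nat
  proof (induction j)
    case (Suc j)
    have "b \<otimes> a [^] Suc j = (b \<otimes> a [^] j) \<otimes> a" using assms by (simp add: m_assoc)
    also have "\<dots> = c ^ j \<odot> (a [^] j \<otimes> (b \<otimes> a))"
      using assms(1,2) by (simp add: Suc m_assoc)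
    also have "\<dots> = c ^ Suc j \<odot> (a [^] Suc j \<otimes> b)"
      using assms by (simp add: m_assoc mult.commute)
    finally show ?case .
  qed (use assms in simp)
  show ?thesis
  proof (induction i)
    case (Suc i)
    have "b [^] Suc i \<otimes> a [^] j = b [^] i \<otimes> (b \<otimes> a [^] j)"
      using assms by (simp add: m_assoc)
    also have "\<dots> = c ^ j \<odot> ((b [^] i \<otimes> a [^] j) \<otimes> b)"
      using assms(1,2) by (simp add: 1 m_assoc)
    also have "\<dots> = c ^ (Suc i * j) \<odot> (a [^] j \<otimes> b [^] Suc i)"
      using assms(1,2) by (simp add: Suc m_assoc power_add)
    finally show ?case .
  qed (use assms in simp)
qed

text \<open>
  Multiplying \<open>a\<^sup>k b\<^bsup>n-k\<^esup>\<close> from the left by \<open>a + b\<close> moves \<open>b\<close> past \<open>a\<^sup>k\<close> and produces the factor \<open>q\<^sup>k\<close>, so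
  the coefficients obey the Pascal rule.
\<close>

lemma q_binomial_theorem:
  assumes ab: "a \<in> carrier A" "b \<in> carrier A" and ba: "b \<otimes> a = q \<odot> (a \<otimes> b)"
  shows "(a \<oplus> b) [^] n = (\<Oplus>k\<in>{..n}. q_binomial q n k \<odot> (a [^] k \<otimes> b [^] (n - k)))"
proof (induction n)
  case 0
  then show ?case using ab by simp
next
  case (Suc n)
  let ?c = "q_binomial q"
  let ?s = "\<lambda>k. (q ^ k * ?c n k) \<odot> (a [^] k \<otimes> b [^] (Suc n - k))"
  have s: "?s \<in> S \<rightarrow> carrier A" for S using ab by auto
  have "(a \<oplus> b) [^] Suc n = (a \<oplus> b) \<otimes> (a \<oplus> b) [^] n"
    using ab nat_pow_Suc2[of "a \<oplus> b" n] by simp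
  also have "\<dots> = (\<Oplus>k\<in>{..n}. (a \<oplus> b) \<otimes> (?c n k \<odot> (a [^] k \<otimes> b [^] (n - k))))"
    unfolding Suc using ab by (intro finsum_rdistr) auto
  also have "\<dots> = (\<Oplus>k\<in>{..n}. ?c n k \<odot> (a [^] Suc k \<otimes> b [^] (n - k)) \<oplus> ?s k)"
  proof (rule finsum_cong')
    fix k assume k: "k \<in> {..n}"
    have "a \<otimes> a [^] k = a [^] Suc k" using ab nat_pow_Suc2[of a k] by simp
    moreover have "b \<otimes> a [^] k = q ^ k \<odot> (a [^] k \<otimes> b)"
      using q_commute_pow[OF ab ba, of 1 k] ab by simp
    moreover have "b \<otimes> b [^] (n - k) = b [^] (Suc n - k)"
      using ab k nat_pow_Suc2[of b "n - k"] by (simp add: Suc_diff_le)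
    ultimately have "a \<otimes> (a [^] k \<otimes> b [^] (n - k)) = a [^] Suc k \<otimes> b [^] (n - k)"
      "b \<otimes> (a [^] k \<otimes> b [^] (n - k)) = q ^ k \<odot> (a [^] k \<otimes> b [^] (Suc n - k))"
      using ab by (simp_all add: m_assoc[symmetric] del: nat_pow_Suc) (simp add: m_assoc)
    then show "(a \<oplus> b) \<otimes> (?c n k \<odot> (a [^] k \<otimes> b [^] (n - k))) =
        ?c n k \<odot> (a [^] Suc k \<otimes> b [^] (n - k)) \<oplus> ?s k"
      using ab by (simp add: l_distr smult_r_distr mult.commute del: nat_pow_Suc)
  qed (use ab in auto)
  also have "\<dots> = (\<Oplus>k\<in>{..n}. ?c n k \<odot> (a [^] Suc k \<otimes> b [^] (n - k))) \<oplus> (\<Oplus>k\<in>{..n}. ?s k)"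
    using ab by (intro finsum_addf) auto
  also have "(\<Oplus>k\<in>{..n}. ?s k) = (\<Oplus>k\<in>{..Suc n}. ?s k)"
    using s ab by (subst finsum_Suc) (simp_all add: q_binomial_gt)
  also have "\<dots> = (\<Oplus>k\<in>{..n}. ?s (Suc k)) \<oplus> ?s 0"
    using s by (rule finsum_Suc2)
  also have "(\<Oplus>k\<in>{..n}. ?c n k \<odot> (a [^] Suc k \<otimes> b [^] (n - k))) \<oplus> \<dots> =
      (\<Oplus>k\<in>{..n}. ?c n k \<odot> (a [^] Suc k \<otimes> b [^] (n - k)) \<oplus> ?s (Suc k)) \<oplus> ?s 0"
    using ab by (subst finsum_addf) (auto simp: a_assoc)
  also have "(\<Oplus>k\<in>{..n}. ?c n k \<odot> (a [^] Suc k \<otimes> b [^] (n - k)) \<oplus> ?s (Suc k)) =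
      (\<Oplus>k\<in>{..n}. ?c (Suc n) (Suc k) \<odot> (a [^] Suc k \<otimes> b [^] (Suc n - Suc k)))"
    using ab by (intro finsum_cong') (auto simp: smult_l_distr)
  also have "?s 0 = ?c (Suc n) 0 \<odot> (a [^] (0::nat) \<otimes> b [^] (Suc n - 0))" by simp
  also have "(\<Oplus>k\<in>{..n}. ?c (Suc n) (Suc k) \<odot> (a [^] Suc k \<otimes> b [^] (Suc n - Suc k))) \<oplus> \<dots> =
      (\<Oplus>k\<in>{..Suc n}. ?c (Suc n) k \<odot> (a [^] k \<otimes> b [^] (Suc n - k)))"
    using ab by (subst finsum_Suc2) auto
  finally show ?case .
qed

text \<open>
  In the \<open>q\<close>-binomial expansion the inner coefficients vanish by absorption, and the outer terms are
  \<open>a\<^sup>m\<close> and \<open>b\<^sup>m\<close>.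
\<close>

lemma nilpotent_sum:
  assumes ab: "a \<in> carrier A" "b \<in> carrier A" and ba: "b \<otimes> a = q \<odot> (a \<otimes> b)"
    and nil: "a [^] m = \<zero>" "b [^] m = \<zero>"
    and q: "\<And>k. q ^ k = 1 \<longleftrightarrow> m dvd k"
  shows "(a \<oplus> b) [^] m = \<zero>"
proof -
  have "q_binomial q m k \<odot> (a [^] k \<otimes> b [^] (m - k)) = \<zero>" if k: "k \<le> m" for k
  proof -
    consider "k = 0" | "k = m" | "0 < k" "k < m" using k by (metis gr0I le_neq_implies_less)
    then show ?thesis
    proof cases
      case 3
      then obtain j l where jl: "k = Suc j" "m = Suc l" by (metis gr0_implies_Suc less_nat_zero_code not0_implies_Suc)
      have "q ^ k \<noteq> 1" "q ^ m = 1" using q[of k] q[of m] 3 by (auto dest: dvd_imp_le)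
      then have "q_binomial q m k = 0"
        using q_binomial_absorption[of q j l] unfolding jl by simp
      then show ?thesis using ab by simp
    qed (use ab nil in simp_all)
  qed
  then show ?thesis
    unfolding q_binomial_theorem[OF ab ba] by (subst finsum_cong'[where g = "\<lambda>_. \<zero>"]) auto
qed

end

section \<open>New solutions of the relations from old ones\<close>

context k_algebra
begin

text \<open>
  Proportionality carries nilpotency over from \<open>a\<close> to \<open>a b\<close>; the factor is a power of \<open>c\<close>.
\<close>

lemma q_commute_mult_pow:
  assumes ab: "a \<in> carrier A" "b \<in> carrier A" and ba: "b \<otimes> a = c \<odot> (a \<otimes> b)"
  shows "\<exists>d. (a \<otimes> b) [^] (k::nat) = d \<odot> (a [^] k \<otimes> b [^] k)"
proof (induction k)
  case 0
  show ?case by (rule exI[of _ 1]) simp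
next
  case (Suc k)
  then obtain d where d: "(a \<otimes> b) [^] k = d \<odot> (a [^] k \<otimes> b [^] k)" by blast
  have "(a \<otimes> b) [^] Suc k = d \<odot> (a [^] k \<otimes> (b [^] k \<otimes> a) \<otimes> b)"
    using ab by (simp add: d m_assoc)
  also have "b [^] k \<otimes> a = c ^ k \<odot> (a \<otimes> b [^] k)"
    using q_commute_pow[OF ab ba, of k 1] ab by simp
  also have "d \<odot> (a [^] k \<otimes> (c ^ k \<odot> (a \<otimes> b [^] k)) \<otimes> b) =
      (d * c ^ k) \<odot> (a [^] Suc k \<otimes> b [^] Suc k)"
    using ab by (simp add: m_assoc)
  finally show ?case by blast
qed

lemma q_commute_flip:
  assumes "a \<in> carrier A" "b \<in> carrier A" "b \<otimes> a = c \<odot> (a \<otimes> b)" "c \<noteq> 0"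
  shows "a \<otimes> b = inverse c \<odot> (b \<otimes> a)"
  using assms by simp

lemma pow_dvd_eq_one:
  assumes "a \<in> carrier A" "a [^] m = \<one>" "m dvd k"
  shows "a [^] (k::nat) = \<one>"
  using assms by (auto simp: nat_pow_pow[symmetric])

end

text \<open>
  The images of the generators under the candidate isomorphism.
\<close>

definition twist_generators ::
  "('k::field, 'a, 'm) module_scheme \<Rightarrow> nat \<Rightarrow> nat \<Rightarrow> (gen \<Rightarrow> 'a) \<Rightarrow> gen \<Rightarrow> 'a" where
  "twist_generators A s l \<phi> y =
     (case y of
        Gen_g \<Rightarrow> \<phi> Gen_g [^]\<^bsub>A\<^esub> s \<otimes>\<^bsub>A\<^esub> \<phi> Gen_h [^]\<^bsub>A\<^esub> l
      | Gen_h \<Rightarrow> \<phi> Gen_h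
      | Gen_x \<Rightarrow> \<phi> Gen_x)"

definition comult_generators ::
  "('k::field, 'a, 'm) module_scheme \<Rightarrow> (gen \<Rightarrow> 'a) \<Rightarrow> gen \<Rightarrow> (('a \<times> 'a) \<Rightarrow>\<^sub>0 'k) set" where
  "comult_generators A \<phi> y =
     (case y of
        Gen_g \<Rightarrow> pure_tensor A A (\<phi> Gen_g) (\<phi> Gen_g)
      | Gen_h \<Rightarrow> pure_tensor A A (\<phi> Gen_h) (\<phi> Gen_h)
      | Gen_x \<Rightarrow> pure_tensor A A (\<phi> Gen_x) (\<phi> Gen_h) \<oplus>\<^bsub>tensor_algebra A A\<^esub>
          pure_tensor A A \<one>\<^bsub>A\<^esub> (\<phi> Gen_x))"

definition antipode_generators ::
  "('k::field, 'a, 'm) module_scheme \<Rightarrow> nat \<Rightarrow> nat \<Rightarrow> (gen \<Rightarrow> 'a) \<Rightarrow> gen \<Rightarrow> 'a" where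
  "antipode_generators A n m \<phi> y =
     (case y of
        Gen_g \<Rightarrow> \<phi> Gen_g [^]\<^bsub>A\<^esub> (n - 1)
      | Gen_h \<Rightarrow> \<phi> Gen_h [^]\<^bsub>A\<^esub> (m - 1)
      | Gen_x \<Rightarrow> \<ominus>\<^bsub>A\<^esub> (\<phi> Gen_x \<otimes>\<^bsub>A\<^esub> \<phi> Gen_h [^]\<^bsub>A\<^esub> (m - 1)))"

lemma all_gen: "(\<forall>y. P y) \<longleftrightarrow> P Gen_g \<and> P Gen_h \<and> P Gen_x"
  by (metis gen.exhaust)

text \<open>
  The condition on \<open>q\<close> says that \<open>q\<close> has multiplicative order \<open>m\<close>.
\<close>

locale T_parameters =
  fixes n m :: nat and q \<omega> :: "'k::field"
  assumes n_pos: "0 < n" and m_pos: "0 < m"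
    and q_pow: "\<And>k. q ^ k = 1 \<longleftrightarrow> m dvd k"
    and \<omega>_pow: "\<omega> ^ n = 1"
begin

lemma q_nonzero: "q \<noteq> 0"
  using q_pow[of m] m_pos by (auto simp: power_0_left)

lemma \<omega>_nonzero: "\<omega> \<noteq> 0"
  using \<omega>_pow n_pos by (auto simp: power_0_left)

end

locale T_solution = k_algebra A + T_parameters n m q \<omega>
  for A :: "('k::field, 'a, 'm) module_scheme" (structure) and n m q \<omega> +
  fixes \<phi> :: "gen \<Rightarrow> 'a"
  assumes relations: "satisfies_T_relations n m q \<omega> A \<phi>"
begin

abbreviation "g \<equiv> \<phi> Gen_g"
abbreviation "h \<equiv> \<phi> Gen_h"
abbreviation "x \<equiv> \<phi> Gen_x"

lemma gen_closed [simp]: "\<phi> y \<in> carrier A"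
  using relations by (simp add: satisfies_T_relations_def)

lemma rel:
  "g [^] n = \<one>" "h [^] m = \<one>" "x [^] m = \<zero>"
  "x \<otimes> h = q \<odot> (h \<otimes> x)" "h \<otimes> g = g \<otimes> h" "g \<otimes> x = \<omega> \<odot> (x \<otimes> g)"
  using relations by (simp_all add: satisfies_T_relations_def)

lemma gh_pow: "h [^] (i::nat) \<otimes> g [^] (j::nat) = g [^] j \<otimes> h [^] i"
  using q_commute_pow[of g h 1 i j] rel(5) by simp

lemma xh_pow: "x \<otimes> h [^] (i::nat) = q ^ i \<odot> (h [^] i \<otimes> x)"
  using q_commute_pow[of h x q 1 i] rel(4) by simp

lemma hx_pow: "h [^] (i::nat) \<otimes> x = inverse (q ^ i) \<odot> (x \<otimes> h [^] i)"
  using q_nonzero by (intro q_commute_flip xh_pow) simp_all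

lemma gx_pow: "g [^] (i::nat) \<otimes> x = \<omega> ^ i \<odot> (x \<otimes> g [^] i)"
  using q_commute_pow[of x g \<omega> i 1] rel(6) by simp

lemma gh_mult_pow: "(g [^] (i::nat) \<otimes> h [^] (j::nat)) [^] (k::nat) = g [^] (i * k) \<otimes> h [^] (j * k)"
  using gh_pow[of j i] by (simp add: pow_mult_distrib nat_pow_pow)

text \<open>
  Moving \<open>x\<close> past \<open>g\<^sup>s\<close> produces \<open>\<omega>\<^sup>s\<close>, and moving it past \<open>h\<^sup>l\<close> produces \<open>q\<^sup>-\<^sup>l\<close>.
\<close>

lemma satisfies_twisted:
  assumes s: "\<omega> ^ s = q ^ l * \<omega>'" and l: "m dvd l * n"
  shows "satisfies_T_relations n m q \<omega>' A (twist_generators A s l \<phi>)"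
proof -
  let ?g = "g [^] s \<otimes> h [^] l"
  have "?g [^] n = \<one>"
    unfolding gh_mult_pow using pow_dvd_eq_one[OF _ rel(1), of "s * n"] pow_dvd_eq_one[OF _ rel(2) l]
    by simp
  moreover have "h \<otimes> ?g = ?g \<otimes> h"
  proof -
    have "h \<otimes> ?g = (h \<otimes> g [^] s) \<otimes> h [^] l" by (simp add: m_assoc)
    also have "h \<otimes> g [^] s = g [^] s \<otimes> h" using gh_pow[of 1 s] by simp
    also have "(g [^] s \<otimes> h) \<otimes> h [^] l = g [^] s \<otimes> (h [^] l \<otimes> h)"
      using nat_pow_Suc2[of h l] by (simp add: m_assoc)
    finally show ?thesis by (simp add: m_assoc)
  qed
  moreover have "?g \<otimes> x = \<omega>' \<odot> (x \<otimes> ?g)"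
  proof -
    have "?g \<otimes> x = g [^] s \<otimes> (h [^] l \<otimes> x)" by (simp add: m_assoc)
    also have "\<dots> = inverse (q ^ l) \<odot> ((g [^] s \<otimes> x) \<otimes> h [^] l)"
      by (simp add: hx_pow m_assoc)
    also have "\<dots> = (inverse (q ^ l) * \<omega> ^ s) \<odot> (x \<otimes> ?g)"
      by (simp add: gx_pow m_assoc)
    also have "inverse (q ^ l) * \<omega> ^ s = \<omega>'" using q_nonzero by (simp add: s)
    finally show ?thesis .
  qed
  ultimately show ?thesis
    by (simp add: satisfies_T_relations_def twist_generators_def all_gen rel)
qed

text \<open>
  In the tensor product \<open>(1 \<otimes> x)(x \<otimes> h) = q (x \<otimes> h)(1 \<otimes> x)\<close>, and both summands have \<open>m\<close>-th power zero.
  The remaining relations hold factor by factor.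
\<close>

lemma satisfies_comult:
  "satisfies_T_relations n m q \<omega> (tensor_algebra A A) (comult_generators A \<phi>)"
proof -
  interpret AA: algebra_pair A A ..
  let ?T = "tensor_algebra A A"
  interpret T: k_algebra ?T by (rule AA.k_algebra_tensor_algebra)
  let ?pt = "pure_tensor A A"
  note pt = AA.pure_tensor_mult AA.pure_tensor_smult_left AA.pure_tensor_smult_right AA.pure_tensor_pow
  have one: "?pt \<one> \<one> = \<one>\<^bsub>?T\<^esub>" by (simp add: tensor_algebra_def)
  have "(?pt x h \<oplus>\<^bsub>?T\<^esub> ?pt \<one> x) [^]\<^bsub>?T\<^esub> m = \<zero>\<^bsub>?T\<^esub>"
    using q_pow
    by (intro T.nilpotent_sum) (simp_all add: pt rel AA.pure_tensor_zero)
  moreover have "(?pt x h \<oplus>\<^bsub>?T\<^esub> ?pt \<one> x) \<otimes>\<^bsub>?T\<^esub> ?pt h h =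
      q \<odot>\<^bsub>?T\<^esub> (?pt h h \<otimes>\<^bsub>?T\<^esub> (?pt x h \<oplus>\<^bsub>?T\<^esub> ?pt \<one> x))"
    by (simp add: T.l_distr T.r_distr T.smult_r_distr pt rel)
  moreover have "?pt g g \<otimes>\<^bsub>?T\<^esub> (?pt x h \<oplus>\<^bsub>?T\<^esub> ?pt \<one> x) =
      \<omega> \<odot>\<^bsub>?T\<^esub> ((?pt x h \<oplus>\<^bsub>?T\<^esub> ?pt \<one> x) \<otimes>\<^bsub>?T\<^esub> ?pt g g)"
    by (simp add: T.l_distr T.r_distr T.smult_r_distr pt rel)
  ultimately show ?thesis
    by (simp add: satisfies_T_relations_def comult_generators_def all_gen pt rel one)
qed

text \<open>
  With \<open>g\<^bsup>n-1\<^esup> = g\<^sup>-\<^sup>1\<close> and \<open>h\<^bsup>m-1\<^esup> = h\<^sup>-\<^sup>1\<close>, inverting \<open>g\<close> and \<open>h\<close> inverts the commutation factors with \<open>x\<close>,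
  and reversing the product inverts them once more.
\<close>

lemma satisfies_antipode:
  "satisfies_T_relations n m q \<omega> (opposite_algebra A) (antipode_generators A n m \<phi>)"
proof -
  interpret O: k_algebra "opposite_algebra A" by (intro k_algebra_opposite k_algebra_axioms)
  let ?G = "g [^] (n - 1)" and ?H = "h [^] (m - 1)"
  let ?X = "x \<otimes> ?H"
  have X: "\<ominus> ?X = (- 1) \<odot> ?X" by (simp add: smult_minus_one)
  have pow: "?G [^] n = \<one>" "?H [^] m = \<one>"
    using pow_dvd_eq_one[OF _ rel(1)] pow_dvd_eq_one[OF _ rel(2)] by (simp_all add: nat_pow_pow)
  obtain d where "?X [^] m = d \<odot> (x [^] m \<otimes> ?H [^] m)"
    using q_commute_mult_pow[OF _ _ hx_pow, of "m - 1" m] by auto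
  then have nil: "((- 1) \<odot> ?X) [^] m = \<zero>" by (simp add: rel smult_pow)
  have "q * q ^ (m - 1) = q ^ m" using m_pos by (simp add: power_eq_if)
  then have qq: "q * (q ^ (m - 1) * q ^ (m - 1)) = q ^ (m - 1)"
    using q_pow[of m] by (simp add: mult.assoc[symmetric])
  have "q \<odot> (?X \<otimes> ?H) = (q * (q ^ (m - 1) * q ^ (m - 1))) \<odot> (?H \<otimes> (?H \<otimes> x))"
    by (simp add: xh_pow m_assoc)
  then have xh: "?H \<otimes> ?X = q \<odot> (?X \<otimes> ?H)"
    unfolding qq by (simp add: xh_pow)
  have gx: "?X \<otimes> ?G = \<omega> \<odot> (?G \<otimes> ?X)"
  proof -
    have "\<omega> \<odot> (?G \<otimes> ?X) = \<omega> \<odot> ((?G \<otimes> x) \<otimes> ?H)" by (simp add: m_assoc)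
    also have "\<dots> = (\<omega> * \<omega> ^ (n - 1)) \<odot> (x \<otimes> (?G \<otimes> ?H))"
      by (simp add: gx_pow m_assoc)
    also have "\<omega> * \<omega> ^ (n - 1) = 1" using n_pos \<omega>_pow by (simp add: power_eq_if)
    finally show ?thesis by (simp add: gh_pow m_assoc)
  qed
  show ?thesis
    unfolding satisfies_T_relations_def antipode_generators_def all_gen gen.case X
    using pow nil xh gx gh_pow[of "m - 1" "n - 1"]
    by (simp add: opposite_algebra_pow[OF k_algebra_axioms] mult.commute)
qed

end

section \<open>The Hopf algebra structure of \<open>T\<close>\<close>

lemma scalar_algebra_simps [simp]:
  "carrier scalar_algebra = UNIV" "monoid.mult scalar_algebra = (*)" "one scalar_algebra = 1"
  "zero scalar_algebra = 0" "add scalar_algebra = (+)" "smult scalar_algebra = (*)"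
  by (simp_all add: scalar_algebra_def)

lemma k_algebra_scalar_algebra: "k_algebra (scalar_algebra :: ('k::field, 'k) module)"
proof -
  have "ring (scalar_algebra :: ('k, 'k) module)"
  proof (rule ringI)
    show "abelian_group (scalar_algebra :: ('k, 'k) module)"
      by (rule abelian_groupI) (auto intro: exI[of _ "- x" for x] simp: algebra_simps)
    show "Group.monoid (scalar_algebra :: ('k, 'k) module)"
      by (rule monoidI) (simp_all add: algebra_simps)
  qed (simp_all add: algebra_simps)
  then show ?thesis
    by (intro k_algebra.intro k_algebra_axioms.intro) (simp_all add: algebra_simps)
qed

lemma scalar_algebra_pow [simp]: "(a :: 'k::field) [^]\<^bsub>scalar_algebra\<^esub> (k::nat) = a ^ k"
proof -
  interpret k_algebra "scalar_algebra :: ('k, 'k) module" by (rule k_algebra_scalar_algebra)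
  show ?thesis by (induction k) (simp_all add: mult.commute)
qed

lemma T_hopf_simps:
  "carrier (T_hopf n m q \<omega>) = carrier (T_algebra n m q \<omega>)"
  "monoid.mult (T_hopf n m q \<omega>) = monoid.mult (T_algebra n m q \<omega>)"
  "one (T_hopf n m q \<omega>) = one (T_algebra n m q \<omega>)"
  "zero (T_hopf n m q \<omega>) = zero (T_algebra n m q \<omega>)"
  "add (T_hopf n m q \<omega>) = add (T_algebra n m q \<omega>)"
  "smult (T_hopf n m q \<omega>) = smult (T_algebra n m q \<omega>)"
  "comult (T_hopf n m q \<omega>) = (\<lambda>Y. the_elem (free_lift
     (tensor_algebra (T_algebra n m q \<omega>) (T_algebra n m q \<omega>)) (T_comult_gen n m q \<omega>) ` Y))"
  "counit (T_hopf n m q \<omega>) = (\<lambda>Y. the_elem (free_lift scalar_algebra T_counit_gen ` Y))"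
  "antipode (T_hopf n m q \<omega>) = (\<lambda>Y. the_elem (free_lift
     (opposite_algebra (T_algebra n m q \<omega>)) (T_antipode_gen n m q \<omega>) ` Y))"
  by (simp_all add: T_hopf_def Let_def module.defs hopf_algebra.defs)

text \<open>
  The bilinearity relations see only the carrier, the addition and the scalars, so adding the
  Hopf structure maps to the record does not change them.
\<close>

lemma tensor_null_subset:
  assumes "carrier A \<subseteq> carrier A'" "add A = add A'" "smult A = smult A'"
  shows "tensor_null A A \<subseteq> tensor_null A' A'"
proof
  fix u assume "u \<in> tensor_null A A"
  then show "u \<in> tensor_null A' A'"
    by induction (use assms in \<open>auto intro: tensor_null.intros simp del: scale_simps(5)\<close>)
qed

lemma tensor_map_T_hopf:
  "tensor_map (T_hopf n m q \<omega>) (T_hopf n m q \<omega>) =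
     tensor_map (T_algebra n m q \<omega>) (T_algebra n m q \<omega>)"
proof -
  have "tensor_null (T_hopf n m q \<omega>) (T_hopf n m q \<omega>) =
      tensor_null (T_algebra n m q \<omega>) (T_algebra n m q \<omega>)"
    by (intro equalityI tensor_null_subset) (simp_all add: T_hopf_simps)
  then show ?thesis by (simp add: fun_eq_iff tensor_map_def tensor_class_def)
qed

context T_parameters
begin

abbreviation "T \<equiv> T_algebra n m q \<omega>"
abbreviation "H \<equiv> T_hopf n m q \<omega>"

lemma T_solution: "T_solution T n m q \<omega> (T_gen n m q \<omega>)"
  by (intro T_solution.intro k_algebra_T T_parameters_axioms T_solution_axioms.intro
      T_satisfies_relations)

lemma comult_hom:
  "comult H \<in> algebra_hom T (tensor_algebra T T)"
  "comult H (T_gen n m q \<omega> y) = comult_generators T (T_gen n m q \<omega>) y"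
proof -
  interpret T_solution T n m q \<omega> "T_gen n m q \<omega>" by (rule T_solution)
  have eq: "T_comult_gen n m q \<omega> = comult_generators T (T_gen n m q \<omega>)"
    by (simp add: fun_eq_iff T_comult_gen_def comult_generators_def Let_def split: gen.split)
  have "algebra_pair T T" by (intro algebra_pair.intro k_algebra_T)
  note * = T_universal_property[OF algebra_pair.k_algebra_tensor_algebra[OF this] satisfies_comult]
  show "comult H \<in> algebra_hom T (tensor_algebra T T)"
    "comult H (T_gen n m q \<omega> y) = comult_generators T (T_gen n m q \<omega>) y"
    unfolding T_hopf_simps eq by (rule *)+
qed

lemma counit_hom:
  "counit H \<in> algebra_hom T scalar_algebra"
  "counit H (T_gen n m q \<omega> y) = T_counit_gen y"
proof -
  have "satisfies_T_relations n m q \<omega> scalar_algebra T_counit_gen"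
    using m_pos by (simp add: satisfies_T_relations_def T_counit_gen_def power_0_left)
  note * = T_universal_property[OF k_algebra_scalar_algebra this]
  show "counit H \<in> algebra_hom T scalar_algebra"
    "counit H (T_gen n m q \<omega> y) = T_counit_gen y"
    unfolding T_hopf_simps by (rule *)+
qed

lemma antipode_hom:
  "antipode H \<in> algebra_hom T (opposite_algebra T)"
  "antipode H (T_gen n m q \<omega> y) = antipode_generators T n m (T_gen n m q \<omega>) y"
proof -
  interpret T_solution T n m q \<omega> "T_gen n m q \<omega>" by (rule T_solution)
  have eq: "T_antipode_gen n m q \<omega> = antipode_generators T n m (T_gen n m q \<omega>)"
    by (simp add: fun_eq_iff T_antipode_gen_def antipode_generators_def Let_def split: gen.split)
  note * = T_universal_property[OF k_algebra_opposite[OF k_algebra_T] satisfies_antipode]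
  show "antipode H \<in> algebra_hom T (opposite_algebra T)"
    "antipode H (T_gen n m q \<omega> y) = antipode_generators T n m (T_gen n m q \<omega>) y"
    unfolding T_hopf_simps eq by (rule *)+
qed

end

section \<open>Isomorphisms from the arithmetic condition\<close>

lemma id_algebra_hom: "(\<lambda>a. a) \<in> algebra_hom A A"
  by (rule algebra_homI) simp_all

definition twist_map :: "nat \<Rightarrow> nat \<Rightarrow> 'k::field \<Rightarrow> 'k \<Rightarrow> nat \<Rightarrow> nat \<Rightarrow> 'k free set \<Rightarrow> 'k free set" where
  "twist_map n m q \<omega> s l Y =
     the_elem (free_lift (T_algebra n m q \<omega>)
       (twist_generators (T_algebra n m q \<omega>) s l (T_gen n m q \<omega>)) ` Y)"

lemma (in T_parameters) twist_map:
  assumes "\<omega> ^ s = q ^ l * \<omega>'" and "m dvd l * n"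
  shows "twist_map n m q \<omega> s l \<in> algebra_hom (T_algebra n m q \<omega>') T"
    and "twist_map n m q \<omega> s l (T_gen n m q \<omega>' y) = twist_generators T s l (T_gen n m q \<omega>) y"
proof -
  interpret T_solution T n m q \<omega> "T_gen n m q \<omega>" by (rule T_solution)
  note * = T_universal_property[OF k_algebra_axioms satisfies_twisted[OF assms]]
  show "twist_map n m q \<omega> s l \<in> algebra_hom (T_algebra n m q \<omega>') T"
    "twist_map n m q \<omega> s l (T_gen n m q \<omega>' y) = twist_generators T s l (T_gen n m q \<omega>) y"
    unfolding twist_map_def by (rule *)+
qed

text \<open>
  The composite fixes \<open>h\<close> and \<open>x\<close> and sends \<open>g\<close> to \<open>(g\<^sup>s h\<^sup>l)\<^bsup>s'\<^esup> h\<^bsup>l'\<^esup>\<close>, which is \<open>g\<close> because \<open>s s'\<close> is \<open>1\<close> modulo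
  \<open>n\<close> and \<open>l s' + l'\<close> is \<open>0\<close> modulo \<open>m\<close>.
\<close>

lemma twist_map_inverse:
  fixes q \<omega> \<omega>' :: "'k::field"
  assumes T: "T_parameters n m q \<omega>" and T': "T_parameters n m q \<omega>'"
    and s: "\<omega> ^ s = q ^ l * \<omega>'" and l: "m dvd l * n"
    and s': "\<omega>' ^ s' = q ^ l' * \<omega>" and l': "m dvd l' * n"
    and ss': "s * s' = Suc (k * n)" and ll': "m dvd l * s' + l'"
    and Y: "Y \<in> carrier (T_algebra n m q \<omega>)"
  shows "twist_map n m q \<omega> s l (twist_map n m q \<omega>' s' l' Y) = Y"
proof -
  interpret T: T_parameters n m q \<omega> by fact
  interpret T': T_parameters n m q \<omega>' by fact
  interpret T_solution T.T n m q \<omega> "T_gen n m q \<omega>" by (rule T.T_solution)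
  let ?f = "twist_map n m q \<omega> s l" and ?f' = "twist_map n m q \<omega>' s' l'"
  note f = T.twist_map[OF s l] and f' = T'.twist_map[OF s' l']
  note hom = algebra_homD[OF f(1)]
  have pow: "?f (a [^]\<^bsub>T'.T\<^esub> i) = ?f a [^]\<^bsub>T.T\<^esub> i" if "a \<in> carrier T'.T" for a and i :: nat
    by (rule algebra_hom_pow[OF k_algebra_T k_algebra_T f(1) that])
  interpret A: k_algebra T'.T by (rule k_algebra_T)
  have "g [^]\<^bsub>T.T\<^esub> (s * s') = g"
    unfolding ss' using pow_dvd_eq_one[OF _ rel(1), of "k * n"] by simp
  moreover have "h [^]\<^bsub>T.T\<^esub> (l * s') \<otimes>\<^bsub>T.T\<^esub> h [^]\<^bsub>T.T\<^esub> l' = \<one>\<^bsub>T.T\<^esub>"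
    using pow_dvd_eq_one[OF _ rel(2) ll'] by (simp add: nat_pow_mult)
  ultimately have "(g [^]\<^bsub>T.T\<^esub> s \<otimes>\<^bsub>T.T\<^esub> h [^]\<^bsub>T.T\<^esub> l) [^]\<^bsub>T.T\<^esub> s' \<otimes>\<^bsub>T.T\<^esub> h [^]\<^bsub>T.T\<^esub> l' = g"
    by (simp add: gh_mult_pow m_assoc)
  then have "?f (?f' (T_gen n m q \<omega> y)) = T_gen n m q \<omega> y" for y
    by (cases y) (simp_all add: f(2) f'(2) twist_generators_def hom pow)
  then show ?thesis
    by (rule T_hom_eqI[OF algebra_hom_comp[OF f'(1) f(1)] id_algebra_hom _ Y])
qed

text \<open>
  Bijectivity comes from the twist in the other direction. Each compatibility with the structure
  maps equates two algebra maps out of \<open>T\<close>, where the target is the opposite algebra for the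
  antipode, and so needs checking only on \<open>g\<close>, \<open>h\<close> and \<open>x\<close>.
\<close>

lemma hopf_isomorphic_if:
  fixes q \<omega> \<omega>' :: "'k::field"
  assumes T: "T_parameters n m q \<omega>" and T': "T_parameters n m q \<omega>'"
    and s: "\<omega> ^ s = q ^ l * \<omega>'" and coprime: "coprime s n" and n: "n \<noteq> 1"
  shows "hopf_isomorphic (T_hopf n m q \<omega>') (T_hopf n m q \<omega>)"
proof -
  interpret T: T_parameters n m q \<omega> by fact
  interpret T': T_parameters n m q \<omega>' by fact
  interpret T_solution T.T n m q \<omega> "T_gen n m q \<omega>" by (rule T.T_solution)
  interpret A: k_algebra T'.T by (rule k_algebra_T)
  obtain s' k where ss': "s * s' = Suc (k * n)"
  proof -
    obtain s' k where "s * s' = n * k + gcd s n"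
      using bezout_nat[of s n] T.n_pos coprime n by (metis coprime_iff_gcd_eq_1 coprime_0_left_iff is_unit_gcd nat_dvd_1_iff_1)
    then show ?thesis using coprime that[of s' k] by (simp add: mult.commute)
  qed
  have "(q ^ l * \<omega>') ^ n = (\<omega> ^ n) ^ s"
    unfolding s[symmetric] by (simp add: power_mult[symmetric] mult.commute)
  then have "q ^ (l * n) = 1"
    by (simp add: power_mult_distrib T.\<omega>_pow T'.\<omega>_pow power_mult)
  then have l: "m dvd l * n" using T.q_pow by blast
  \<comment> \<open>A natural number congruent to \<open>- l s'\<close> modulo \<open>m\<close>.\<close>
  define l' where "l' = (m - 1) * (l * s')"
  have l': "m dvd l' * n" 
  proof -
    have "l' * n = ((m - 1) * s') * (l * n)" by (simp add: l'_def mult.commute mult.left_commute)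
    then show ?thesis using dvd_mult[OF l] by metis
  qed
  have ll': "m dvd l * s' + l'"
  proof -
    have "l * s' + l' = m * (l * s')" using T.m_pos by (cases m) (simp_all add: l'_def)
    then show ?thesis by simp
  qed
  have l'l: "m dvd l' * s + l"
  proof -
    have "l' * s + l + l * k * n = (m - 1) * (l * (s * s')) + l * Suc (k * n)"
      by (simp add: l'_def algebra_simps)
    also have "\<dots> = m * (l * Suc (k * n))" unfolding ss' using T.m_pos by (cases m) simp_all
    finally have "m dvd l' * s + l + l * k * n" by simp
    moreover have "m dvd l * k * n" using l by (simp add: mult.commute mult.left_commute)
    ultimately show ?thesis by (metis dvd_add_left_iff)
  qed
  have s': "\<omega>' ^ s' = q ^ l' * \<omega>"
  proof -
    have "q ^ (l * s') * \<omega>' ^ s' = \<omega> ^ (s * s')"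
      by (simp add: power_mult s power_mult_distrib)
    also have "\<dots> = \<omega>" unfolding ss' by (simp add: power_mult mult.commute[of k] T.\<omega>_pow)
    finally have "q ^ l' * \<omega> = q ^ (l * s' + l') * \<omega>' ^ s'" by (simp add: power_add algebra_simps)
    then show ?thesis using T.q_pow ll' by simp
  qed
  let ?f = "twist_map n m q \<omega> s l" and ?f' = "twist_map n m q \<omega>' s' l'"
  note f = T.twist_map[OF s l] and f' = T'.twist_map[OF s' l']
  note hom = algebra_homD[OF f(1)]
  have bij: "bij_betw ?f (carrier T'.T) (carrier T.T)"
  proof (rule bij_betw_byWitness[of _ ?f'])
    have "s' * s = Suc (k * n)" using ss' by (simp add: mult.commute)
    then show "\<forall>Y\<in>carrier T'.T. ?f' (?f Y) = Y"
      using twist_map_inverse[OF T' T s' l' s l _ l'l] by blast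
    show "\<forall>Y\<in>carrier T.T. ?f (?f' Y) = Y"
      using twist_map_inverse[OF T T' s l s' l' ss' ll'] by blast
    show "?f ` carrier T'.T \<subseteq> carrier T.T" "?f' ` carrier T.T \<subseteq> carrier T'.T"
      using hom(1) algebra_homD(1)[OF f'(1)] by auto
  qed
  have iso: "?f \<in> algebra_iso T'.H T.H"
    using f(1) bij
    by (simp add: algebra_iso_def algebra_hom_def ring_iso_def ring_hom_def T_hopf_simps)
  note \<Delta> = T.comult_hom(1) and \<Delta>' = T'.comult_hom(1)
  note S = T.antipode_hom(1) and S' = T'.antipode_hom(1)
  note counit = T.counit_hom(1) and counit' = T'.counit_hom(1)
  have pair: "algebra_pair T.T T.T" "algebra_pair T'.T T'.T"
    by (intro algebra_pair.intro k_algebra_T)+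
  interpret TT: algebra_pair T.T T.T by (rule pair)
  interpret TT': algebra_pair T'.T T'.T by (rule pair)
  note ff = tensor_map_hom[OF pair(2,1) f(1) f(1)]
  note pow_f = algebra_hom_pow[OF k_algebra_T k_algebra_T f(1)]
  note pow_\<Delta> = algebra_hom_pow[OF k_algebra_T TT.k_algebra_tensor_algebra \<Delta>]
  note pow_counit = algebra_hom_pow[OF k_algebra_T k_algebra_scalar_algebra counit]
  note pow_S = algebra_hom_pow[OF k_algebra_T k_algebra_opposite[OF k_algebra_T] S]
  have comult: "comult T.H (?f Y) = tensor_map T.T T.T ?f ?f (comult T'.H Y)"
    if "Y \<in> carrier T'.T" for Y
  proof (rule T_hom_eqI[OF algebra_hom_comp[OF f(1) \<Delta>] algebra_hom_comp[OF \<Delta>' ff(1)] _ that])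
    fix y
    show "comult T.H (?f (T_gen n m q \<omega>' y)) =
        tensor_map T.T T.T ?f ?f (comult T'.H (T_gen n m q \<omega>' y))"
      by (cases y)
        (simp_all add: f(2) T.comult_hom(2) T'.comult_hom(2) comult_generators_def
          twist_generators_def algebra_homD[OF \<Delta>] algebra_homD[OF ff(1)] ff(2) hom(4)
          pow_\<Delta> TT.pure_tensor_pow TT.pure_tensor_mult)
  qed
  have counit_eq: "counit T.H (?f Y) = counit T'.H Y" if "Y \<in> carrier T'.T" for Y
  proof (rule T_hom_eqI[OF algebra_hom_comp[OF f(1) counit] counit' _ that])
    fix y
    show "counit T.H (?f (T_gen n m q \<omega>' y)) = counit T'.H (T_gen n m q \<omega>' y)"
      by (cases y)
        (simp_all add: f(2) T.counit_hom(2) T'.counit_hom(2) T_counit_gen_def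
          twist_generators_def algebra_homD[OF counit] pow_counit)
  qed
  have antipode_g: "h [^]\<^bsub>T.T\<^esub> ((m - 1) * l) \<otimes>\<^bsub>T.T\<^esub> g [^]\<^bsub>T.T\<^esub> ((n - 1) * s) =
      (g [^]\<^bsub>T.T\<^esub> s \<otimes>\<^bsub>T.T\<^esub> h [^]\<^bsub>T.T\<^esub> l) [^]\<^bsub>T.T\<^esub> (n - 1)"
  proof -
    \<comment> \<open>Both sides are inverse to \<open>h\<^sup>l\<close>, one since \<open>m\<close> divides \<open>l n\<close> and one since \<open>h\<^sup>m = 1\<close>.\<close>
    have "h [^]\<^bsub>T.T\<^esub> (l * (n - 1)) = h [^]\<^bsub>T.T\<^esub> ((m - 1) * l)"
    proof (rule inv_unique[of _ "h [^]\<^bsub>T.T\<^esub> l"])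
      have "l * (n - 1) + l = l * n" using T.n_pos by (cases n) simp_all
      then show "h [^]\<^bsub>T.T\<^esub> (l * (n - 1)) \<otimes>\<^bsub>T.T\<^esub> h [^]\<^bsub>T.T\<^esub> l = \<one>\<^bsub>T.T\<^esub>"
        using pow_dvd_eq_one[OF _ rel(2) l] by (simp add: nat_pow_mult)
      have "l + (m - 1) * l = m * l" using T.m_pos by (cases m) simp_all
      then show "h [^]\<^bsub>T.T\<^esub> l \<otimes>\<^bsub>T.T\<^esub> h [^]\<^bsub>T.T\<^esub> ((m - 1) * l) = \<one>\<^bsub>T.T\<^esub>"
        using pow_dvd_eq_one[OF _ rel(2), of "m * l"] by (simp add: nat_pow_mult)
    qed simp_all
    then show ?thesis by (simp add: gh_mult_pow gh_pow mult.commute)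
  qed
  have antipode_eq: "antipode T.H (?f Y) = ?f (antipode T'.H Y)" if "Y \<in> carrier T'.T" for Y
  proof (rule T_hom_eqI[OF algebra_hom_comp[OF f(1) S]
        algebra_hom_comp[OF S' algebra_hom_opposite[OF f(1)]] _ that])
    fix y
    show "antipode T.H (?f (T_gen n m q \<omega>' y)) = ?f (antipode T'.H (T_gen n m q \<omega>' y))"
      using antipode_g
      by (cases y)
        (simp_all add: f(2) T.antipode_hom(2) T'.antipode_hom(2) antipode_generators_def
          twist_generators_def algebra_homD[OF S] hom pow_f pow_S opposite_algebra_pow k_algebra_T
          nat_pow_pow algebra_hom_minus[OF k_algebra_T k_algebra_T f(1)])
  qed
  have "?f \<in> hopf_iso T'.H T.H"
    using iso by (simp add: hopf_iso_def T_hopf_simps(1) tensor_map_T_hopf comult counit_eq antipode_eq)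
  then show ?thesis by (auto simp: hopf_isomorphic_def)
qed

section \<open>Non-split extensions of characters\<close>

text \<open>
  The triple \<open>(a, b, d)\<close> stands for the matrix with rows \<open>(a, d)\<close> and \<open>(0, b)\<close>.
\<close>

definition upper_triangular :: "('k::field, 'k \<times> 'k \<times> 'k) module" where
  "upper_triangular =
     \<lparr>carrier = UNIV,
      monoid.mult = (\<lambda>(a, b, d) (a', b', d'). (a * a', b * b', a * d' + d * b')),
      one = (1, 1, 0),
      zero = (0, 0, 0),
      add = (\<lambda>(a, b, d) (a', b', d'). (a + a', b + b', d + d')),
      smult = (\<lambda>c (a, b, d). (c * a, c * b, c * d))\<rparr>"

lemma upper_triangular_simps [simp]:
  "carrier upper_triangular = UNIV"
  "(a, b, d) \<otimes>\<^bsub>upper_triangular\<^esub> (a', b', d') = (a * a', b * b', a * d' + d * b')"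
  "one upper_triangular = (1, 1, 0)"
  "zero upper_triangular = (0, 0, 0)"
  "(a, b, d) \<oplus>\<^bsub>upper_triangular\<^esub> (a', b', d') = (a + a', b + b', d + d')"
  "c \<odot>\<^bsub>upper_triangular\<^esub> (a, b, d) = (c * a, c * b, c * d)"
  by (simp_all add: upper_triangular_def)

lemma k_algebra_upper_triangular:
  "k_algebra (upper_triangular :: ('k::field, 'k \<times> 'k \<times> 'k) module)"
proof -
  let ?U = "upper_triangular :: ('k, 'k \<times> 'k \<times> 'k) module"
  have "ring ?U"
  proof (rule ringI)
    show "abelian_group ?U"
    proof (rule abelian_groupI)
      fix u :: "'k \<times> 'k \<times> 'k"
      obtain a b d where "u = (a, b, d)" by (cases u)
      then show "\<exists>v\<in>carrier ?U. v \<oplus>\<^bsub>?U\<^esub> u = \<zero>\<^bsub>?U\<^esub>"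
        by (intro bexI[of _ "(- a, - b, - d)"]) simp_all
    qed (auto simp: algebra_simps)
    show "Group.monoid ?U"
      by (rule monoidI) (auto simp: algebra_simps)
  qed (auto simp: algebra_simps)
  then show ?thesis
    by (intro k_algebra.intro k_algebra_axioms.intro) (auto simp: algebra_simps)
qed

lemma upper_triangular_diag_pow:
  "(a, b, 0) [^]\<^bsub>upper_triangular\<^esub> (k::nat) = (a ^ k, b ^ k, 0 :: 'k::field)"
proof -
  interpret k_algebra "upper_triangular :: ('k, 'k \<times> 'k \<times> 'k) module"
    by (rule k_algebra_upper_triangular)
  show ?thesis by (induction k) (simp_all add: mult.commute)
qed

lemma upper_triangular_strict_pow:
  assumes "2 \<le> k"
  shows "(0, 0, d) [^]\<^bsub>upper_triangular\<^esub> (k::nat) = (0, 0, 0 :: 'k::field)"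
proof -
  interpret k_algebra "upper_triangular :: ('k, 'k \<times> 'k \<times> 'k) module"
    by (rule k_algebra_upper_triangular)
  obtain i where "k = Suc (Suc i)" using assms by (metis Suc_le_D numeral_2_eq_2 Suc_le_mono)
  moreover obtain a b e where "(0, 0, d) [^]\<^bsub>upper_triangular\<^esub> i = (a, b, e)"
    by (cases "(0, 0, d) [^]\<^bsub>upper_triangular\<^esub> i")
  ultimately show ?thesis by simp
qed

text \<open>
  Conjugating the diagonal representation \<open>(\<alpha>, \<beta>)\<close> by a unipotent matrix puts \<open>c (\<alpha> - \<beta>)\<close> off the
  diagonal, so the last clause says that the extension does not split.
\<close>

definition non_split :: "('k::field, 'a, 'm) module_scheme \<Rightarrow> ('a \<Rightarrow> 'k \<times> 'k \<times> 'k) \<Rightarrow> bool" where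
  "non_split A \<rho> \<longleftrightarrow>
     \<rho> \<in> algebra_hom A upper_triangular \<and>
     (\<exists>a\<in>carrier A. fst (\<rho> a) \<noteq> fst (snd (\<rho> a))) \<and>
     (\<nexists>c. \<forall>a\<in>carrier A. snd (snd (\<rho> a)) = c * (fst (\<rho> a) - fst (snd (\<rho> a))))"

lemma upper_triangular_characters:
  assumes \<rho>: "\<rho> \<in> algebra_hom A upper_triangular"
  shows "(\<lambda>a. fst (\<rho> a)) \<in> algebra_hom A scalar_algebra"
    and "(\<lambda>a. fst (snd (\<rho> a))) \<in> algebra_hom A scalar_algebra"
proof -
  have "fst \<in> algebra_hom upper_triangular scalar_algebra"
    "(\<lambda>u. fst (snd u)) \<in> algebra_hom upper_triangular scalar_algebra"
    by (rule algebra_homI; auto)+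
  then show "(\<lambda>a. fst (\<rho> a)) \<in> algebra_hom A scalar_algebra"
    "(\<lambda>a. fst (snd (\<rho> a))) \<in> algebra_hom A scalar_algebra"
    using algebra_hom_comp[OF \<rho>] by auto
qed

lemma split_extension_hom:
  assumes \<alpha>: "\<alpha> \<in> algebra_hom A scalar_algebra" and \<beta>: "\<beta> \<in> algebra_hom A scalar_algebra"
  shows "(\<lambda>a. (\<alpha> a, \<beta> a, c * (\<alpha> a - \<beta> a))) \<in> algebra_hom A upper_triangular"
  by (rule algebra_homI)
    (simp_all add: algebra_homD[OF \<alpha>, simplified] algebra_homD[OF \<beta>, simplified] algebra_simps)

lemma non_split_pullback:
  assumes f: "f \<in> algebra_hom A B" and surj: "f ` carrier A = carrier B" and \<rho>: "non_split B \<rho>"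
  shows "non_split A (\<lambda>a. \<rho> (f a))"
  using \<rho> algebra_hom_comp[OF f, of \<rho> upper_triangular]
  unfolding non_split_def surj[symmetric] by auto

context T_parameters
begin

text \<open>
  The relation \<open>x h = q h x\<close> forces a character to vanish on \<open>x\<close> when \<open>q \<noteq> 1\<close>.
\<close>

lemma character_on_generators:
  assumes \<alpha>: "\<alpha> \<in> algebra_hom T scalar_algebra"
  shows "\<alpha> (T_gen n m q \<omega> Gen_g) \<noteq> 0" and "\<alpha> (T_gen n m q \<omega> Gen_h) \<noteq> 0"
    and "q \<noteq> 1 \<Longrightarrow> \<alpha> (T_gen n m q \<omega> Gen_x) = 0"
proof -
  interpret T_solution T n m q \<omega> "T_gen n m q \<omega>" by (rule T_solution)
  note hom = algebra_homD[OF \<alpha>, simplified]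
  note pow = algebra_hom_pow[OF k_algebra_T k_algebra_scalar_algebra \<alpha>, simplified]
  have "\<alpha> g ^ n = 1" "\<alpha> h ^ m = 1"
    using pow[of g n] pow[of h m] by (simp_all add: rel hom)
  then show 1: "\<alpha> g \<noteq> 0" "\<alpha> h \<noteq> 0" using n_pos m_pos by (auto simp: power_0_left)
  have "\<alpha> x * \<alpha> h = q * (\<alpha> h * \<alpha> x)" using arg_cong[OF rel(4), of \<alpha>] by (simp add: hom)
  then show "\<alpha> x = 0" if "q \<noteq> 1" using 1 that by (simp add: algebra_simps)
qed

text \<open>
  The entries off the diagonal form a derivation \<open>\<delta>\<close> relative to the characters \<open>\<alpha>\<close> and \<open>\<beta>\<close>. If
  \<open>\<delta>\<close> vanished on \<open>x\<close>, then commutativity of \<open>g\<close> and \<open>h\<close> would make \<open>\<delta>\<close> proportional to \<open>\<alpha> - \<beta>\<close> on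
  all generators and the extension would split. So \<open>\<delta>(x) \<noteq> 0\<close>, and applying \<open>\<delta>\<close> to \<open>g x = \<omega> x g\<close>
  compares \<open>\<alpha>(g)\<close> with \<open>\<beta>(g)\<close>.
\<close>

lemma non_split_T:
  assumes \<rho>: "non_split T \<rho>" and q: "q \<noteq> 1"
  shows "fst (\<rho> (T_gen n m q \<omega> Gen_g)) = \<omega> * fst (snd (\<rho> (T_gen n m q \<omega> Gen_g)))"
proof -
  interpret T_solution T n m q \<omega> "T_gen n m q \<omega>" by (rule T_solution)
  define \<alpha> \<beta> \<delta> where "\<alpha> = (\<lambda>a. fst (\<rho> a))" "\<beta> = (\<lambda>a. fst (snd (\<rho> a)))" "\<delta> = (\<lambda>a. snd (snd (\<rho> a)))"
  have \<rho>_eq: "\<rho> a = (\<alpha> a, \<beta> a, \<delta> a)" for a by (simp add: \<alpha>_\<beta>_\<delta>_def)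
  have hom: "\<rho> \<in> algebra_hom T upper_triangular" using \<rho> by (simp add: non_split_def)
  have \<alpha>: "\<alpha> \<in> algebra_hom T scalar_algebra" and \<beta>: "\<beta> \<in> algebra_hom T scalar_algebra"
    unfolding \<alpha>_\<beta>_\<delta>_def by (rule upper_triangular_characters[OF hom])+
  note \<rho>_hom = algebra_homD[OF hom, unfolded \<rho>_eq, simplified]
  have mult: "\<delta> (a \<otimes>\<^bsub>T\<^esub> b) = \<alpha> a * \<delta> b + \<delta> a * \<beta> b" if "a \<in> carrier T" "b \<in> carrier T" for a b
    using \<rho>_hom(2)[OF that] by simp
  have smult: "\<delta> (c \<odot>\<^bsub>T\<^esub> a) = c * \<delta> a" if "a \<in> carrier T" for a c
    using \<rho>_hom(5)[OF that] by simp
  have x: "\<alpha> x = 0" "\<beta> x = 0" using character_on_generators(3) \<alpha> \<beta> q by blast+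
  have "\<alpha> g * \<delta> x = \<omega> * (\<delta> x * \<beta> g)"
    using arg_cong[OF rel(6), of \<delta>] by (simp add: mult smult x)
  moreover have "\<delta> x \<noteq> 0"
  proof
    assume \<delta>x: "\<delta> x = 0"
    have comm: "\<delta> g * (\<alpha> h - \<beta> h) = \<delta> h * (\<alpha> g - \<beta> g)"
      using arg_cong[OF rel(5), of \<delta>] by (simp add: mult algebra_simps)
    obtain y where "\<alpha> (T_gen n m q \<omega> y) \<noteq> \<beta> (T_gen n m q \<omega> y)"
      using T_hom_eqI[OF \<alpha> \<beta>] \<rho> by (auto simp: non_split_def \<rho>_eq)
    then have "\<alpha> g \<noteq> \<beta> g \<or> \<alpha> h \<noteq> \<beta> h" by (cases y) (simp_all add: x)
    then obtain c where c: "\<delta> g = c * (\<alpha> g - \<beta> g)" "\<delta> h = c * (\<alpha> h - \<beta> h)"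
    proof
      assume "\<alpha> g \<noteq> \<beta> g"
      then show thesis using comm that[of "\<delta> g / (\<alpha> g - \<beta> g)"] by (simp add: field_simps)
    next
      assume "\<alpha> h \<noteq> \<beta> h"
      then show thesis using comm that[of "\<delta> h / (\<alpha> h - \<beta> h)"] by (simp add: field_simps)
    qed
    have "\<rho> a = (\<alpha> a, \<beta> a, c * (\<alpha> a - \<beta> a))" if "a \<in> carrier T" for a
    proof (rule T_hom_eqI[OF hom split_extension_hom[OF \<alpha> \<beta>] _ that])
      fix y
      show "\<rho> (T_gen n m q \<omega> y) =
          (\<alpha> (T_gen n m q \<omega> y), \<beta> (T_gen n m q \<omega> y), c * (\<alpha> (T_gen n m q \<omega> y) - \<beta> (T_gen n m q \<omega> y)))"
        by (cases y) (simp_all add: \<rho>_eq c x \<delta>x)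
    qed
    then show False using \<rho> unfolding non_split_def by auto
  qed
  ultimately show ?thesis by (simp add: \<rho>_eq)
qed

text \<open>
  The \<open>k\<close>-th extension has the diagonal characters \<open>\<chi>\<^sub>k\<close> and \<open>\<chi>\<^bsub>k+1\<^esub>\<close>, where \<open>\<chi>\<^sub>k\<close> sends \<open>g\<close> to \<open>\<omega>\<^sup>-\<^sup>k\<close>, \<open>h\<close> to
  \<open>q\<^sup>k\<close> and \<open>x\<close> to \<open>0\<close>.
\<close>

definition chain_generators :: "nat \<Rightarrow> gen \<Rightarrow> 'k \<times> 'k \<times> 'k" where
  "chain_generators k y =
     (case y of
        Gen_g \<Rightarrow> (inverse \<omega> ^ k, inverse \<omega> ^ Suc k, 0)
      | Gen_h \<Rightarrow> (q ^ k, q ^ Suc k, 0)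
      | Gen_x \<Rightarrow> (0, 0, 1))"

definition chain :: "nat \<Rightarrow> 'k free set \<Rightarrow> 'k \<times> 'k \<times> 'k" where
  "chain k Y = the_elem (free_lift upper_triangular (chain_generators k) ` Y)"

lemma chain:
  assumes "2 \<le> m"
  shows "chain k \<in> algebra_hom T upper_triangular"
    and "chain k (T_gen n m q \<omega> y) = chain_generators k y"
proof -
  have "(a ^ i) ^ j = 1" if "a ^ j = 1" for a :: 'k and i j
    using that by (metis power_mult mult.commute power_one)
  moreover have "inverse \<omega> ^ n = 1" by (simp add: \<omega>_pow power_inverse)
  moreover have "q ^ m = 1" using q_pow by simp
  ultimately have pow: "(inverse \<omega> ^ i) ^ n = 1" "(q ^ i) ^ m = 1" for i by blast+
  have "satisfies_T_relations n m q \<omega> upper_triangular (chain_generators k)"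
    using assms \<omega>_nonzero pow[of k] pow[of "Suc k"]
    by (simp add: satisfies_T_relations_def chain_generators_def upper_triangular_diag_pow
        upper_triangular_strict_pow)
  note * = T_universal_property[OF k_algebra_upper_triangular this]
  show "chain k \<in> algebra_hom T upper_triangular"
    "chain k (T_gen n m q \<omega> y) = chain_generators k y"
    unfolding chain_def by (rule *)+
qed

lemma non_split_chain:
  assumes "2 \<le> m"
  shows "non_split T (chain k)"
proof -
  have "q \<noteq> 1" using q_pow[of 1] assms by simp
  then have "q ^ k \<noteq> q ^ Suc k" using q_nonzero by simp
  then have "fst (chain k (T_gen n m q \<omega> Gen_h)) \<noteq> fst (snd (chain k (T_gen n m q \<omega> Gen_h)))"
    by (simp add: chain[OF assms] chain_generators_def)
  moreover have "snd (snd (chain k (T_gen n m q \<omega> Gen_x))) \<noteq>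
      c * (fst (chain k (T_gen n m q \<omega> Gen_x)) - fst (snd (chain k (T_gen n m q \<omega> Gen_x))))" for c
    by (simp add: chain[OF assms] chain_generators_def)
  ultimately show ?thesis
    unfolding non_split_def by (intro conjI chain(1)[OF assms] notI) (blast intro: T_gen_closed)+
qed

text \<open>
  This identifies the second character of one link of the chain with the first character of the
  next, and the character at \<open>k\<close> with the one at \<open>0\<close> when the chain closes up.
\<close>

lemma chain_character_eqI:
  assumes "2 \<le> m" and "\<beta> \<in> algebra_hom T scalar_algebra"
    and "inverse \<omega> ^ k = \<beta> (T_gen n m q \<omega> Gen_g)" "q ^ k = \<beta> (T_gen n m q \<omega> Gen_h)"
    and "Y \<in> carrier T"
  shows "fst (chain k Y) = \<beta> Y"
proof (rule T_hom_eqI[OF upper_triangular_characters(1)[OF chain(1)[OF assms(1)]] assms(2) _ assms(5)])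
  fix y
  have "q \<noteq> 1" using q_pow[of 1] assms(1) by simp
  then have "\<beta> (T_gen n m q \<omega> Gen_x) = 0" by (rule character_on_generators(3)[OF assms(2)])
  then show "fst (chain k (T_gen n m q \<omega> y)) = \<beta> (T_gen n m q \<omega> y)"
    using assms by (cases y) (simp_all add: chain[OF assms(1)] chain_generators_def)
qed

end

text \<open>
  The pullbacks to \<open>T\<close> of the characters in the chain for \<open>\<omega>'\<close> are linked by non-split extensions, so
  their values at \<open>g\<close> form a geometric progression with ratio \<open>\<omega>\<^sup>-\<^sup>1\<close>. The chain closes up after \<open>k\<close>
  steps, hence \<open>\<omega>\<^sup>k = 1\<close>.
\<close>

lemma root_of_unity_invariant:
  fixes q \<omega> \<omega>' :: "'k::field"
  assumes T: "T_parameters n m q \<omega>" and T': "T_parameters n m q \<omega>'" and m: "2 \<le> m"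
    and f: "f \<in> algebra_hom (T_algebra n m q \<omega>) (T_algebra n m q \<omega>')"
    and surj: "f ` carrier (T_algebra n m q \<omega>) = carrier (T_algebra n m q \<omega>')"
    and k: "m dvd k" "\<omega>' ^ k = 1"
  shows "\<omega> ^ k = 1"
proof -
  interpret T: T_parameters n m q \<omega> by fact
  interpret T': T_parameters n m q \<omega>' by fact
  let ?g = "T_gen n m q \<omega> Gen_g"
  note f_closed = algebra_homD(1)[OF f T_gen_closed]
  have q: "q \<noteq> 1" using T.q_pow[of 1] m by simp
  define \<alpha> where "\<alpha> j = fst (T'.chain j (f ?g))" for j
  have step: "\<alpha> j = \<omega> * \<alpha> (Suc j)" for j
  proof -
    have "fst (T'.chain (Suc j) (f ?g)) = fst (snd (T'.chain j (f ?g)))"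
      by (rule T'.chain_character_eqI[OF m upper_triangular_characters(2)[OF T'.chain(1)[OF m]] _ _ f_closed])
        (simp_all add: T'.chain[OF m] T'.chain_generators_def)
    then show ?thesis
      using T.non_split_T[OF non_split_pullback[OF f surj T'.non_split_chain[OF m]] q, of j]
      by (simp add: \<alpha>_def)
  qed
  have "\<alpha> 0 = \<omega> ^ j * \<alpha> j" for j
  proof (induction j)
    case (Suc j)
    then show ?case using step[of j] by (simp add: mult.assoc mult.left_commute)
  qed simp
  moreover have "\<alpha> k = \<alpha> 0"
    unfolding \<alpha>_def
    by (rule T'.chain_character_eqI[OF m upper_triangular_characters(1)[OF T'.chain(1)[OF m]] _ _ f_closed])
      (use k T'.q_pow in \<open>simp_all add: T'.chain[OF m] T'.chain_generators_def power_inverse\<close>)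
  moreover have "\<alpha> 0 \<noteq> 0"
    unfolding \<alpha>_def
    by (rule T.character_on_generators(1)[OF algebra_hom_comp[OF f upper_triangular_characters(1)[OF T'.chain(1)[OF m]]]])
  ultimately show ?thesis by (metis mult_cancel_right1)
qed

lemma algebra_hom_inv_into:
  assumes f: "f \<in> algebra_hom A B" and bij: "bij_betw f (carrier A) (carrier B)"
    and A: "k_algebra A"
  shows "inv_into (carrier A) f \<in> algebra_hom B A"
proof -
  interpret k_algebra A by fact
  let ?g = "inv_into (carrier A) f"
  have inj: "inj_on f (carrier A)" and surj: "f ` carrier A = carrier B"
    using bij by (auto simp: bij_betw_def)
  have g: "?g (f a) = a" if "a \<in> carrier A" for a using inj that by simp
  note hom = algebra_homD(2-5)[OF f, symmetric]
  have rep: "\<exists>a\<in>carrier A. b = f a" if "b \<in> carrier B" for b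
    using that surj by auto
  show ?thesis
    by (rule algebra_homI) (auto dest!: rep simp: g hom)
qed

section \<open>Units modulo divisors and roots of unity\<close>

text \<open>
  Units modulo a divisor \<open>b\<close> of \<open>n\<close> lift to units modulo \<open>n\<close>: adding to \<open>a\<close> the product of \<open>b\<close> and all primes
  that divide \<open>n\<close> but not \<open>a\<close> yields a number that no prime divisor of \<open>n\<close> divides.
\<close>

lemma coprime_lift:
  fixes a b n :: nat
  assumes "coprime a b" "b dvd n" "n > 0"
  shows "\<exists>s. [s = a] (mod b) \<and> coprime s n"
proof -
  define P where "P = \<Prod>{p. prime p \<and> p dvd n \<and> \<not> p dvd a}"
  have fin: "finite {p. prime p \<and> p dvd n \<and> \<not> p dvd a}"
    by (rule finite_subset[of _ "{..n}"]) (use assms(3) in \<open>auto dest: dvd_imp_le\<close>)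
  have P: "p dvd P \<longleftrightarrow> p dvd n \<and> \<not> p dvd a" if "prime p" for p
    unfolding P_def using that fin
    by (subst prime_dvd_prod_iff) (auto dest: primes_dvd_imp_eq)
  have "coprime (a + b * P) n"
  proof (rule ccontr)
    assume "\<not> coprime (a + b * P) n"
    then obtain p where p: "prime p" "p dvd a + b * P" "p dvd n"
      by (metis coprime_iff_gcd_eq_1 prime_factor_nat gcd_nat.boundedE)
    show False
    proof (cases "p dvd a")
      case True
      then have "p dvd b * P" using p by (simp add: dvd_add_right_iff)
      moreover have "\<not> p dvd b" using True assms(1) p(1) by (meson coprime_common_divisor not_prime_unit)
      ultimately show False using P[OF p(1)] True p(1) by (simp add: prime_dvd_mult_iff)
    next
      case False
      then show False using p P[OF p(1)] by (simp add: dvd_add_left_iff)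
    qed
  qed
  moreover have "[a + b * P = a] (mod b)" by (simp add: cong_def)
  ultimately show ?thesis by blast
qed

text \<open>
  Equal annihilators modulo \<open>N\<close> give \<open>gcd u N = gcd u' N = d\<close>. The quotients of \<open>u\<close> and \<open>u'\<close> by \<open>d\<close> are
  units modulo \<open>N / d\<close>, so they differ by a unit there, which lifts to a unit modulo \<open>n\<close>.
\<close>

lemma same_annihilator_imp_unit_multiple:
  fixes u u' N n :: nat
  assumes N: "N > 0" "N dvd n" "n > 0" and ann: "\<And>j. N dvd u * j \<longleftrightarrow> N dvd u' * j"
  shows "\<exists>s. coprime s n \<and> [s * u' = u] (mod N)"
proof -
  have sub: "gcd v N dvd v'" if imp: "\<And>j. N dvd v * j \<Longrightarrow> N dvd v' * j" for v v' :: nat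
  proof -
    define d where "d = gcd v N"
    have "d dvd v" "d dvd N" by (simp_all add: d_def)
    then obtain c e where c: "v = d * c" and e: "N = d * e" by (elim dvdE)
    \<comment> \<open>The annihilator of \<open>v\<close> contains \<open>e = N / d\<close>.\<close>
    have "N dvd v * e" unfolding c e by simp
    then have "d * e dvd v' * e" using imp e by blast
    moreover have "e > 0" using N(1) e by (cases e) simp_all
    ultimately have "d dvd v'" by simp
    then show ?thesis by (simp add: d_def)
  qed
  define d where "d = gcd u N"
  have "gcd u N dvd gcd u' N" "gcd u' N dvd gcd u N"
    using sub[of u u'] sub[of u' u] ann by auto
  then have d': "d = gcd u' N" unfolding d_def by (rule dvd_antisym)
  have "d > 0" using N by (simp add: d_def)
  have "d dvd u" "d dvd N" "d dvd u'" by (simp add: d_def, simp add: d_def, simp add: d')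
  then obtain a b a' where u: "u = d * a" "N = d * b" "u' = d * a'" by (elim dvdE)
  have "d * gcd a b = d" "d * gcd a' b = d"
    by (simp_all only: gcd_mult_distrib_nat u[symmetric] d_def[symmetric] d'[symmetric])
  then have co: "coprime a b" "coprime a' b"
    using \<open>d > 0\<close> by (simp_all add: coprime_iff_gcd_eq_1)
  obtain c where c: "[a' * c = 1] (mod b)" using cong_solve_coprime_nat[OF co(2)] by auto
  then have "coprime c b" by (metis cong_imp_coprime cong_sym coprime_1_left coprime_mult_left_iff)
  then have "coprime (a * c) b" using co by simp
  moreover have "b dvd n" using N u by (metis dvd_mult_right)
  ultimately obtain s where s: "[s = a * c] (mod b)" "coprime s n"
    using coprime_lift N by blast
  have "[s * a' = a * c * a'] (mod b)" using s(1) by (rule cong_scalar_right)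
  also have "a * c * a' = a * (a' * c)" by simp
  also have "[a * (a' * c) = a * 1] (mod b)" using c by (rule cong_scalar_left)
  finally have "[d * (s * a') = d * a] (mod d * b)"
    by (simp add: cong_def mult_mod_right[symmetric])
  then have "[s * u' = u] (mod N)" unfolding u by (simp add: mult.left_commute)
  then show ?thesis using s by blast
qed

lemma power_cong:
  fixes z :: "'k::field"
  assumes "z ^ N = 1" "[i = j] (mod N)"
  shows "z ^ i = z ^ j"
proof -
  have "z ^ i = z ^ (i mod N)" for i
  proof -
    have "z ^ i = z ^ (N * (i div N) + i mod N)" by simp
    also have "\<dots> = z ^ (i mod N)" unfolding power_add power_mult assms(1) by simp
    finally show ?thesis .
  qed
  then show ?thesis using assms(2) by (metis cong_def)
qed

lemma root_of_unity_order:
  fixes z :: "'k::field"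
  assumes "z ^ n = 1" "n > 0"
  obtains N where "N > 0" "\<And>i. z ^ i = 1 \<longleftrightarrow> N dvd i"
proof -
  define N where "N = (LEAST i. i > 0 \<and> z ^ i = 1)"
  have N: "N > 0" "z ^ N = 1"
    using LeastI[of "\<lambda>i. i > 0 \<and> z ^ i = 1" n] assms by (auto simp: N_def)
  have "z ^ i = z ^ (i mod N)" for i
    by (rule power_cong[OF N(2)]) (simp add: cong_def)
  moreover have "z ^ j \<noteq> 1" if "0 < j" "j < N" for j
    using not_less_Least[of j "\<lambda>i. i > 0 \<and> z ^ i = 1"] that by (auto simp: N_def)
  ultimately have "z ^ i = 1 \<longleftrightarrow> N dvd i" for i
    using N(1) by (metis dvd_imp_mod_0 mod_0_imp_dvd mod_less_divisor gr0I power_0)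
  then show thesis using N(1) that by blast
qed

text \<open>
  The powers of \<open>q\<close> exhaust a set of \<open>m\<close> elements, so the order of \<open>q\<close>, a divisor of \<open>m\<close>, is at least
  \<open>m\<close>.
\<close>

lemma primitive_root_of_unityD:
  fixes q :: "'k::field"
  assumes q: "primitive_root_of_unity m q" and m: "m > 0"
  shows "q ^ k = 1 \<longleftrightarrow> m dvd k"
    and "z ^ m = 1 \<Longrightarrow> \<exists>l<m. z = q ^ l"
proof -
  let ?G = "roots_of_unity m :: 'k monoid"
  have G: "carrier ?G = {z. z ^ m = 1}" "monoid.mult ?G = (*)" "one ?G = 1"
    by (simp_all add: roots_of_unity_def)
  have card: "card (carrier ?G) = m" and gen: "generate ?G {q} = carrier ?G" and q1: "q ^ m = 1"
    using q G by (auto simp: primitive_root_of_unity_def generates_group_def order_def)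
  have "group ?G"
  proof (rule groupI)
    fix z assume "z \<in> carrier ?G"
    then have z: "z ^ m = 1" by (simp add: G)
    then have "(z ^ (m - 1)) ^ m = 1" by (metis power_mult mult.commute power_one)
    then show "\<exists>y\<in>carrier ?G. y \<otimes>\<^bsub>?G\<^esub> z = \<one>\<^bsub>?G\<^esub>"
      using z power_minus_mult[OF m, of z] by (intro bexI[of _ "z ^ (m - 1)"]) (simp_all add: G)
  qed (simp_all add: G power_mult_distrib mult.assoc)
  then interpret group ?G .
  have fin: "finite (carrier ?G)" using card m card.infinite by fastforce
  have pow: "z [^]\<^bsub>?G\<^esub> (k::nat) = z ^ k" for z k
    by (induction k) (simp_all add: G mult.commute)
  have "carrier ?G = {q ^ k | k. k \<in> (UNIV :: nat set)}"
    using generate_pow_on_finite_carrier[OF fin, of q] gen q1 by (simp add: G pow)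
  then have powers: "\<exists>k. z = q ^ k" if "z ^ m = 1" for z using that G by auto
  obtain N where N: "N > 0" "\<And>i. q ^ i = 1 \<longleftrightarrow> N dvd i"
    using root_of_unity_order[OF q1 m] by blast
  have "q ^ k = q ^ (k mod N)" for k
    by (rule power_cong[of _ N]) (simp_all add: N cong_def)
  then have powers': "\<exists>l<N. z = q ^ l" if "z ^ m = 1" for z
    using powers[OF that] N(1) by (metis mod_less_divisor)
  then have "carrier ?G \<subseteq> (\<lambda>l. q ^ l) ` {..<N}" by (auto simp: G)
  then have "m \<le> N" using card surj_card_le[of "{..<N}"] by fastforce
  moreover have "N dvd m" using N q1 by blast
  ultimately have "N = m" using m by (meson dvd_imp_le le_antisym)
  then show "q ^ k = 1 \<longleftrightarrow> m dvd k" "z ^ m = 1 \<Longrightarrow> \<exists>l<m. z = q ^ l"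
    using N powers' by auto
qed

section \<open>Classification up to isomorphism\<close>

theorem theorem3p4:
  fixes m n t t' :: nat and q \<xi> :: "'k::field"
  assumes "m \<ge> 3" and "n \<ge> 2"
    and "primitive_root_of_unity m q"
    and "generates_group (roots_of_unity n) \<xi>"
    and "t \<in> {0..order (roots_of_unity n :: 'k monoid) - 1}"
    and "t' \<in> {0..order (roots_of_unity n :: 'k monoid) - 1}"
  shows "hopf_isomorphic (T_hopf n m q (\<xi> ^ t)) (T_hopf n m q (\<xi> ^ t')) \<longleftrightarrow>
    (\<exists>l\<in>{0..m - 1}. \<exists>s\<in>{0..n - 1}.
       gcd s n = 1 \<and> \<xi> powi (int s * int t' - int t) = q ^ l)"
proof -
  have mn: "m > 0" "n > 0" "n \<noteq> 1" "2 \<le> m" using assms(1,2) by auto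
  note q = primitive_root_of_unityD[OF assms(3) mn(1)]
  have \<xi>: "\<xi> ^ n = 1"
    using assms(4) by (simp add: generates_group_def roots_of_unity_def)
  then have \<xi>_nz: "\<xi> \<noteq> 0" using mn by (auto simp: power_0_left)
  have \<xi>_pow: "(\<xi> ^ i) ^ n = 1" for i using \<xi> by (metis mult.commute power_mult power_one)
  have T: "T_parameters n m q (\<xi> ^ i)" for i
    using mn q(1) \<xi>_pow by unfold_locales auto
  have powi: "\<xi> powi (int s * int t' - int t) = q ^ l \<longleftrightarrow> (\<xi> ^ t') ^ s = q ^ l * \<xi> ^ t" for s l
  proof -
    have "\<xi> powi (int s * int t' - int t) = (\<xi> ^ t') ^ s / \<xi> ^ t"
      using \<xi>_nz by (simp add: power_int_diff power_mult[symmetric] mult.commute flip: of_nat_mult)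
    then show ?thesis using \<xi>_nz by (simp only: divide_eq_eq) simp
  qed
  show ?thesis
  proof
    assume "hopf_isomorphic (T_hopf n m q (\<xi> ^ t)) (T_hopf n m q (\<xi> ^ t'))"
    then obtain f where "f \<in> hopf_iso (T_hopf n m q (\<xi> ^ t)) (T_hopf n m q (\<xi> ^ t'))"
      by (auto simp: hopf_isomorphic_def)
    then have f: "f \<in> algebra_hom (T_algebra n m q (\<xi> ^ t)) (T_algebra n m q (\<xi> ^ t'))"
      and bij: "bij_betw f (carrier (T_algebra n m q (\<xi> ^ t))) (carrier (T_algebra n m q (\<xi> ^ t')))"
      by (simp_all add: hopf_iso_def algebra_iso_def algebra_hom_def ring_iso_def ring_hom_def
          T_hopf_simps)
    have inv: "inv_into (carrier (T_algebra n m q (\<xi> ^ t))) f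
        \<in> algebra_hom (T_algebra n m q (\<xi> ^ t')) (T_algebra n m q (\<xi> ^ t))"
      by (rule algebra_hom_inv_into[OF f bij k_algebra_T])
    have same: "(\<xi> ^ t) ^ k = 1 \<longleftrightarrow> (\<xi> ^ t') ^ k = 1" if "m dvd k" for k
      using root_of_unity_invariant[OF T T mn(4) f bij_betw_imp_surj_on[OF bij] that]
        root_of_unity_invariant[OF T T mn(4) inv bij_betw_imp_surj_on[OF bij_betw_inv_into[OF bij]] that]
      by blast
    obtain N where N: "N > 0" "\<And>i. \<xi> ^ i = 1 \<longleftrightarrow> N dvd i"
      using root_of_unity_order[OF \<xi> mn(2)] by blast
    \<comment> \<open>Multiples of \<open>m\<close> are the exponents at which the chain also closes up at \<open>h\<close>.\<close>
    have "N dvd (t * m) * j \<longleftrightarrow> N dvd (t' * m) * j" for j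
      using same[of "m * j"] by (simp add: N(2)[symmetric] power_mult[symmetric] mult.assoc)
    then obtain s where s: "coprime s n" "[s * (t' * m) = t * m] (mod N)"
      using same_annihilator_imp_unit_multiple[OF N(1) _ mn(2)] N(2) \<xi> by blast
    then have "\<xi> ^ (s * (t' * m)) = \<xi> ^ (t * m)"
      using N(2) by (intro power_cong[of _ N]) auto
    then have "((\<xi> ^ t') ^ s / \<xi> ^ t) ^ m = 1"
      using \<xi>_nz by (simp add: power_divide power_mult[symmetric] mult.assoc mult.left_commute mult.commute)
    then obtain l where l: "l < m" "(\<xi> ^ t') ^ s / \<xi> ^ t = q ^ l" using q(2) by blast
    \<comment> \<open>Reducing \<open>s\<close> modulo \<open>n\<close> brings it into the required range.\<close>
    have "(\<xi> ^ t') ^ (s mod n) = (\<xi> ^ t') ^ s"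
      by (rule power_cong[OF \<xi>_pow]) (simp add: cong_def)
    then have "\<xi> powi (int (s mod n) * int t' - int t) = q ^ l"
      unfolding powi using l \<xi>_nz by (simp add: field_simps)
    moreover have "gcd (s mod n) n = 1" using s(1) by (metis coprime_iff_gcd_eq_1 gcd.commute gcd_red_nat)
    moreover have "s mod n \<in> {0..n - 1}" "l \<in> {0..m - 1}"
      using mod_less_divisor[OF mn(2), of s] l(1) unfolding atLeastAtMost_iff by linarith+
    ultimately show "\<exists>l\<in>{0..m - 1}. \<exists>s\<in>{0..n - 1}.
        gcd s n = 1 \<and> \<xi> powi (int s * int t' - int t) = q ^ l"
      by (intro bexI[of _ l] bexI[of _ "s mod n"] conjI)
  next
    assume "\<exists>l\<in>{0..m - 1}. \<exists>s\<in>{0..n - 1}.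
        gcd s n = 1 \<and> \<xi> powi (int s * int t' - int t) = q ^ l"
    then obtain l s where "gcd s n = 1" "(\<xi> ^ t') ^ s = q ^ l * \<xi> ^ t"
      unfolding powi by (elim bexE conjE)
    then show "hopf_isomorphic (T_hopf n m q (\<xi> ^ t)) (T_hopf n m q (\<xi> ^ t'))"
      using hopf_isomorphic_if[OF T T] mn(3) by (simp add: coprime_iff_gcd_eq_1)
  qed
qed

end
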